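(* Let $0<\epsilon\le\theta+R_g$ and let $\delta_t$ be a non-negative sequence that converges to $0$. Let $K_q$ be the smallest positive integer such that $\delta_t\le\epsilon/2$ for all $t\ge K_q$. Let $$K_r=\lfloor 10.6\,\Delta_0\rfloor\quad\text{and}\quad K_s=\left\lceil\frac{48(\theta+R_g)^2}{\epsilon}\right\rceil .$$ Then, for the Approximate Generalized Frank-Wolfe algorithm (with the problem $\min_{x\in\mathbb{R}^n}F(x)$ as input, and with the sequence $\delta_t$ as oracle accuracies), there exists some $K\le K_r+2K_s+2K_q$ such that $\Delta_K\le\epsilon$, $G_K^a\le\epsilon$ and $\delta_K\le\epsilon$.
   Context: Setting. $\mathcal{K}\subset\mathbb{R}^d$ is a proper cone. $f$ is a 2-self-concordant, $\theta$-logarithmically-homogeneous barrier on $\mathrm{int}(\mathcal{K})$, that is: $f$ is thrice continuously differentiable and strictly convex on $\mathrm{int}(\mathcal{K})$; $f(w_i)\to\infty$ along every sequence in $\mathrm{int}(\mathcal{K})$ converging to a boundary point of $\mathcal{K}$; $|\nabla^3 f(w)[u,u,u]|\le 2(u^T\nabla^2 f(w)u)^{3/2}$ for all $w\in\mathrm{int}(\mathcal{K})$, $u\in\mathbb{R}^d$; and $f(cw)=f(w)-\theta\log c$ for all $w\in\mathrm{int}(\mathcal{K})$, $c>0$. $\mathcal{B}:\mathbb{R}^n\to\mathbb{R}^d$ is a linear map with adjoint $\mathcal{B}^*$. $g$ is a proper, closed, convex and possibly nonsmooth function with compact nonempty domain, and $\mathrm{int}(\mathcal{K})\cap\mathcal{B}(\mathrm{dom}(g))\ne\emptyset$.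 $R_g=\max_{x_1,x_2\in\mathrm{dom}(g)}|g(x_1)-g(x_2)|$. The problem is $\min_{x\in\mathbb{R}^n}F(x)$ with $F(x)=f(\mathcal{B}(x))+g(x)$; $x$ is feasible if $x\in\mathrm{dom}(g)$ and $\mathcal{B}(x)\in\mathrm{int}(\mathcal{K})$; $x^\star$ is an optimal solution. Notation. $F^{\mathrm{lin}}_{x^t}(h)=\langle\mathcal{B}^*(\nabla f(\mathcal{B}(x^t))),h\rangle+g(h)$, and $h^\star$ is a minimizer of $F^{\mathrm{lin}}_{x^t}$ over $\mathbb{R}^n$. $\|w\|_u=\sqrt{\langle w,\nabla^2 f(u)w\rangle}$. For feasible points $x^t,h^t$: $\Delta_t=F(x^t)-F(x^\star)$ (optimality gap); $G_t^a=F^{\mathrm{lin}}_{x^t}(x^t)-F^{\mathrm{lin}}_{x^t}(h^t)$ (approximate duality gap); $D_t=\|\mathcal{B}(h^t-x^t)\|_{\mathcal{B}(x^t)}$. Oracle ILMO. It takes $x^t$, $\mathcal{B}^*(\nabla f(\mathcal{B}(x^t)))$ and a nonnegative quantity $\delta_t$ as input, and outputs a pair $(h^t,G_t^a)$, where $h^t$ is feasible and $G_t^a$ is the approximate duality gap, such that $G_t^a\ge0$ and at least one of the following holds: (large gap) $G_t^a>\theta+R_g$; ($\delta_t$-suboptimality) $F^{\mathrm{lin}}_{x^t}(h^t)\le F^{\mathrm{lin}}_{x^t}(h^\star)+\delta_t$. Approximate Generalized Frank-Wolfe algorithm (input: the problem above and the suboptimality parameter $\epsilon\le\theta+R_g$).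 Initialize at a feasible $x^0\in\mathbb{R}^n$ and set $t=0$. Repeat: (1) compute $\mathcal{B}^*(\nabla f(\mathcal{B}(x^t)))$ and take $\delta_t\ge0$ from the given sequence; (2) call ILMO with these inputs to obtain $(h^t,G_t^a)$; (3) if $G_t^a\le\epsilon$ and $\delta_t\le 3\epsilon/2$, stop and return $(x^t,\delta_t)$; (4) otherwise compute $D_t$, set $\gamma_t=\min\{G_t^a/(D_t(D_t+G_t^a)),1\}$ (with $\gamma_t=0$ when ILMO returns $(h^t,G_t^a)=(x^t,0)$), set $x^{t+1}=(1-\gamma_t)x^t+\gamma_t h^t$, and increase $t$ by $1$.
   Formalization: The iterates are continued past the stopping test of step (3): a run halted there may contain no such K (it can stop with ε < δ_t ≤ 3ε/2 or with Δ_t > ε). At the K found the test holds, so the algorithm stops no later than K. *)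

theory Defs
  imports "HOL-Analysis.Analysis"
begin

definition proper_cone :: "'b::euclidean_space set \<Rightarrow> bool" where
  "proper_cone K \<longleftrightarrow>
     cone K \<and> convex K \<and> closed K \<and> interior K \<noteq> {} \<and> (\<forall>x. x \<in> K \<and> - x \<in> K \<longrightarrow> x = 0)"

definition strictly_convex_on :: "'b::real_vector set \<Rightarrow> ('b \<Rightarrow> real) \<Rightarrow> bool" where
  "strictly_convex_on S f \<longleftrightarrow>
     convex S \<and>
     (\<forall>x\<in>S. \<forall>y\<in>S. \<forall>s. x \<noteq> y \<and> 0 < s \<and> s < 1 \<longrightarrow>
        f ((1 - s) *\<^sub>R x + s *\<^sub>R y) < (1 - s) * f x + s * f y)"

definition grad :: "('b::euclidean_space \<Rightarrow> real) \<Rightarrow> 'b \<Rightarrow> 'b" where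
  "grad f w = (\<Sum>b\<in>Basis. frechet_derivative f (at w) b *\<^sub>R b)"

definition hess :: "('b::euclidean_space \<Rightarrow> real) \<Rightarrow> 'b \<Rightarrow> 'b \<Rightarrow> 'b" where
  "hess f w u = frechet_derivative (grad f) (at w) u"

definition third_deriv :: "('b::euclidean_space \<Rightarrow> real) \<Rightarrow> 'b \<Rightarrow> 'b \<Rightarrow> 'b \<Rightarrow> 'b \<Rightarrow> real" where
  "third_deriv f w u v z = frechet_derivative (\<lambda>y. hess f y u) (at w) v \<bullet> z"

(* Intended for open S. In finite dimension, testing each fixed direction separately is the
   same as (continuous) differentiability of the operator-valued derivatives. *)
definition C3_on :: "'b::euclidean_space set \<Rightarrow> ('b \<Rightarrow> real) \<Rightarrow> bool" where
  "C3_on S f \<longleftrightarrow>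
     f differentiable_on S \<and>
     grad f differentiable_on S \<and>
     (\<forall>u. (\<lambda>w. hess f w u) differentiable_on S) \<and>
     (\<forall>u v z. continuous_on S (\<lambda>w. third_deriv f w u v z))"

(* Only the values of f on interior K are used. *)
definition self_concordant_lh_barrier ::
    "'b::euclidean_space set \<Rightarrow> real \<Rightarrow> ('b \<Rightarrow> real) \<Rightarrow> bool" where
  "self_concordant_lh_barrier K \<theta> f \<longleftrightarrow>
     C3_on (interior K) f \<and>
     strictly_convex_on (interior K) f \<and>
     (\<forall>w p. (\<forall>i::nat. w i \<in> interior K) \<and> p \<in> frontier K \<and> w \<longlonglongrightarrow> p
        \<longrightarrow> filterlim (\<lambda>i. f (w i)) at_top sequentially) \<and>
     (\<forall>w\<in>interior K. \<forall>u. \<bar>third_deriv f w u u u\<bar> \<le> 2 * (u \<bullet> hess f w u) powr (3/2)) \<and>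
     (\<forall>w\<in>interior K. \<forall>c>0. f (c *\<^sub>R w) = f w - \<theta> * ln c)"

definition local_norm :: "('b::euclidean_space \<Rightarrow> real) \<Rightarrow> 'b \<Rightarrow> 'b \<Rightarrow> real" where
  "local_norm f u w = sqrt (w \<bullet> hess f u w)"

definition edom :: "('a \<Rightarrow> ereal) \<Rightarrow> 'a set" where
  "edom g = {x. g x < \<infinity>}"

definition eepigraph :: "('a \<Rightarrow> ereal) \<Rightarrow> ('a \<times> real) set" where
  "eepigraph g = {(x, r). g x \<le> ereal r}"

definition proper_closed_convex :: "('a::euclidean_space \<Rightarrow> ereal) \<Rightarrow> bool" where
  "proper_closed_convex g \<longleftrightarrow>
     (\<forall>x. g x \<noteq> -\<infinity>) \<and> edom g \<noteq> {} \<and> closed (eepigraph g) \<and> convex (eepigraph g)"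

definition is_max_variation :: "('a \<Rightarrow> ereal) \<Rightarrow> real \<Rightarrow> bool" where
  "is_max_variation g R \<longleftrightarrow>
     (\<exists>x1\<in>edom g. \<exists>x2\<in>edom g. ereal R = \<bar>g x1 - g x2\<bar>) \<and>
     (\<forall>x1\<in>edom g. \<forall>x2\<in>edom g. \<bar>g x1 - g x2\<bar> \<le> ereal R)"

(* The barrier f is read as +infinity outside interior K. *)
definition objective ::
    "'b::euclidean_space set \<Rightarrow> ('b \<Rightarrow> real) \<Rightarrow> ('a::euclidean_space \<Rightarrow> 'b) \<Rightarrow> ('a \<Rightarrow> ereal)
     \<Rightarrow> 'a \<Rightarrow> ereal" where
  "objective K f B g x = (if B x \<in> interior K then ereal (f (B x)) + g x else \<infinity>)"

definition feasible ::
    "'b::euclidean_space set \<Rightarrow> ('a::euclidean_space \<Rightarrow> 'b) \<Rightarrow> ('a \<Rightarrow> ereal) \<Rightarrow> 'a \<Rightarrow> bool" where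
  "feasible K B g x \<longleftrightarrow> x \<in> edom g \<and> B x \<in> interior K"

definition is_minimizer :: "('a \<Rightarrow> ereal) \<Rightarrow> 'a \<Rightarrow> bool" where
  "is_minimizer \<phi> x \<longleftrightarrow> is_arg_min \<phi> (\<lambda>_. True) x"

(* Finite on both sides whenever x is feasible and xstar is optimal. *)
definition opt_gap ::
    "'b::euclidean_space set \<Rightarrow> ('b \<Rightarrow> real) \<Rightarrow> ('a::euclidean_space \<Rightarrow> 'b) \<Rightarrow> ('a \<Rightarrow> ereal)
     \<Rightarrow> 'a \<Rightarrow> 'a \<Rightarrow> real" where
  "opt_gap K f B g xstar x = real_of_ereal (objective K f B g x - objective K f B g xstar)"

definition lin_objective ::
    "('b::euclidean_space \<Rightarrow> real) \<Rightarrow> ('a::euclidean_space \<Rightarrow> 'b) \<Rightarrow> ('a \<Rightarrow> ereal)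
     \<Rightarrow> 'a \<Rightarrow> 'a \<Rightarrow> ereal" where
  "lin_objective f B g x h = ereal (adjoint B (grad f (B x)) \<bullet> h) + g h"

(* (h, G) is an admissible answer of the inexact linear minimization oracle at x with accuracy d.
   A minimizer of the linearized objective always exists, as edom g is compact and g is closed. *)
definition ilmo_answer ::
    "'b::euclidean_space set \<Rightarrow> real \<Rightarrow> ('b \<Rightarrow> real) \<Rightarrow> ('a::euclidean_space \<Rightarrow> 'b) \<Rightarrow> ('a \<Rightarrow> ereal)
     \<Rightarrow> real \<Rightarrow> 'a \<Rightarrow> real \<Rightarrow> 'a \<Rightarrow> real \<Rightarrow> bool" where
  "ilmo_answer K \<theta> f B g R x d h G \<longleftrightarrow>
     feasible K B g h \<and>
     ereal G = lin_objective f B g x x - lin_objective f B g x h \<and>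
     G \<ge> 0 \<and>
     (G > \<theta> + R \<or>
      (\<forall>hstar. is_minimizer (lin_objective f B g x) hstar \<longrightarrow>
         lin_objective f B g x h \<le> lin_objective f B g x hstar + ereal d))"

(* For D > 0 this is min {G / (D * (D + G)), 1}. For D = 0 the quotient is read as
   +infinity if G > 0 and as 0 if G = 0; in particular the step is 0 for the answer (x, 0). *)
definition step_size :: "real \<Rightarrow> real \<Rightarrow> real" where
  "step_size G D = (if G = 0 then 0 else if D = 0 then 1 else min (G / (D * (D + G))) 1)"

(* The sequences produced by the Frank-Wolfe iteration for an arbitrary admissible oracle.
   The stopping test "G t <= eps and d t <= 3 * eps / 2" only selects which iterate the
   algorithm returns; the sequences here are continued past it. *)
definition agfw_iterates ::
    "'b::euclidean_space set \<Rightarrow> real \<Rightarrow> ('b \<Rightarrow> real) \<Rightarrow> ('a::euclidean_space \<Rightarrow> 'b) \<Rightarrow> ('a \<Rightarrow> ereal)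
     \<Rightarrow> real \<Rightarrow> (nat \<Rightarrow> real) \<Rightarrow> (nat \<Rightarrow> 'a) \<Rightarrow> (nat \<Rightarrow> 'a) \<Rightarrow> (nat \<Rightarrow> real) \<Rightarrow> bool" where
  "agfw_iterates K \<theta> f B g R d x h G \<longleftrightarrow>
     feasible K B g (x 0) \<and>
     (\<forall>t. ilmo_answer K \<theta> f B g R (x t) (d t) (h t) (G t)) \<and>
     (\<forall>t. let \<gamma> = step_size (G t) (local_norm f (B (x t)) (B (h t - x t)))
          in x (Suc t) = (1 - \<gamma>) *\<^sub>R x t + \<gamma> *\<^sub>R h t)"

end

theory Submission
  imports Defs
begin

text \<open>
  Self-concordance bounds the change of \<open>f\<close> along a segment by its gradient and the local norm, and logarithmic
  homogeneity gives \<open>D\<^sub>t \<le> G\<^sub>t + M\<close> with \<open>M = \<theta> + R\<^sub>g \<ge> 1\<close>. With the prescribed step size, \<open>\<Delta>\<close> then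
  decreases by at least \<open>1/2 - ln (3/2) > 1 / 10.6\<close> if \<open>G\<^sub>t > M\<close>, and by at least \<open>G\<^sub>t\<^sup>2 / (12 M\<^sup>2)\<close>
  otherwise. In the latter case \<open>\<Delta>\<^sub>t \<le> G\<^sub>t + \<delta>\<^sub>t\<close>, so once \<open>\<delta>\<^sub>t \<le> \<epsilon> / 2\<close> each iteration that does not satisfy
  the claim makes progress in one of three potentials, and these bound the number of such iterations.
\<close>

subsection \<open>Univariate self-concordance\<close>

text \<open>For \<open>x \<ge> 0\<close> the derivative of right minus left is
  \<open>x * (1 - 2 * x) / (3 * (1 + x))\<close>, nonnegative exactly up to \<open>1/2\<close>. This
  range covers \<open>G / (G + M)\<close> when \<open>G \<le> M\<close>.\<close>

lemma ln_one_plus_le_quadratic: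
  fixes s :: real
  assumes "0 \<le> s" "s \<le> 1/2"
  shows "s\<^sup>2 / 3 \<le> s - ln (1 + s)"
proof -
  have "(\<lambda>s. s - ln (1 + s) - s\<^sup>2 / 3) 0 \<le> (\<lambda>s. s - ln (1 + s) - s\<^sup>2 / 3) s"
  proof (rule DERIV_nonneg_imp_nondecreasing[OF assms(1)], intro exI conjI)
    fix x assume x: "0 \<le> x" "x \<le> s"
    show "((\<lambda>s. s - ln (1 + s) - s\<^sup>2 / 3) has_real_derivative (1 - 1 / (1 + x) - 2 * x / 3)) (at x)"
      using x by (auto intro!: derivative_eq_intros)
    have "0 \<le> x * (1 - 2 * x)" using x assms by simp
    then show "0 \<le> 1 - 1 / (1 + x) - 2 * x / 3"
      using x by (simp add: field_simps)
  qed
  then show ?thesis by simp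
qed

text \<open>Serves the capped step \<open>\<gamma> = 1\<close>: there
  \<open>D\<^sup>2 \<le> G * (1 - D)\<close>, so the right-hand side at \<open>D\<close> is at most
  \<open>G / 2\<close>.\<close>

lemma neg_ln_one_minus_le:
  fixes t :: real
  assumes "0 \<le> t" "t < 1"
  shows "- t - ln (1 - t) \<le> t\<^sup>2 / (2 * (1 - t))"
proof -
  let ?k = "\<lambda>t::real. t\<^sup>2 / (2 * (1 - t)) + t + ln (1 - t)"
  have "?k 0 \<le> ?k t"
  proof (rule DERIV_nonneg_imp_nondecreasing[OF assms(1)], intro exI conjI)
    fix x assume x: "0 \<le> x" "x \<le> t"
    have ne: "1 - x > 0" using x assms by simp
    show "(?k has_real_derivative (x\<^sup>2 / (2 * (1 - x)\<^sup>2))) (at x)"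
    proof (rule DERIV_cong)
      show "(?k has_real_derivative (2 * x * (2 * (1 - x)) + 2 * x\<^sup>2) / (2 * (1 - x))\<^sup>2 + 1 - 1 / (1 - x)) (at x)"
        using ne by (auto intro!: derivative_eq_intros simp: power2_eq_square)
      show "(2 * x * (2 * (1 - x)) + 2 * x\<^sup>2) / (2 * (1 - x))\<^sup>2 + 1 - 1 / (1 - x) = x\<^sup>2 / (2 * (1 - x)\<^sup>2)"
        using ne by (simp add: divide_simps) (simp add: power2_eq_square algebra_simps)
    qed
    show "0 \<le> x\<^sup>2 / (2 * (1 - x)\<^sup>2)" by simp
  qed
  then show ?thesis by simp
qed

lemma sub_ln_one_plus_mono:
  fixes r s :: real
  assumes "0 \<le> r" "r \<le> s"
  shows "r - ln (1 + r) \<le> s - ln (1 + s)"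
proof (rule DERIV_nonneg_imp_nondecreasing[OF assms(2)], intro exI conjI)
  fix x assume x: "r \<le> x" "x \<le> s"
  show "((\<lambda>s. s - ln (1 + s)) has_real_derivative (1 - 1 / (1 + x))) (at x)"
    using x assms by (auto intro!: derivative_eq_intros)
  show "0 \<le> 1 - 1 / (1 + x)" using x assms by simp
qed

text \<open>Source of the constant 10.6: \<open>1/2 - ln (3/2)\<close> is about 0.09453, barely
  above \<open>1 / 10.6\<close>. The Taylor polynomial of \<open>exp\<close> of degree 4 at
  \<open>?x\<close> already reaches \<open>3/2\<close>, and its remainder is nonnegative since
  \<open>?x > 0\<close>.\<close>

lemma ln_three_halves_le: "1 / 10.6 \<le> (1/2 :: real) - ln (1 + 1/2)"
proof -
  let ?x = "(1/2 :: real) - 1 / 10.6"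
  obtain t where "exp ?x = (\<Sum>m<5. ?x ^ m / fact m) + exp t / fact 5 * ?x ^ 5"
    using Maclaurin_exp_le[of ?x 5] by blast
  moreover have "0 \<le> exp t / fact 5 * ?x ^ 5" by simp
  moreover have "3/2 \<le> (\<Sum>m<5. ?x ^ m / fact m)"
    by (simp add: eval_nat_numeral)
  ultimately have "1 + 1/2 \<le> exp ?x" by linarith
  then have "ln (1 + 1/2) \<le> ln (exp ?x)" by (subst ln_le_cancel_iff) auto
  then show ?thesis by simp
qed

lemma second_derivative_nonneg_imp_nonneg:
  fixes k k' k'' :: "real \<Rightarrow> real"
  assumes "0 \<le> T"
    and k: "\<And>t. 0 \<le> t \<Longrightarrow> t \<le> T \<Longrightarrow> (k has_real_derivative k' t) (at t)"
    and k': "\<And>t. 0 \<le> t \<Longrightarrow> t \<le> T \<Longrightarrow> (k' has_real_derivative k'' t) (at t)"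
    and nn: "\<And>t. 0 \<le> t \<Longrightarrow> t \<le> T \<Longrightarrow> 0 \<le> k'' t"
    and "k 0 = 0" "k' 0 = 0"
  shows "0 \<le> k T"
proof -
  have 1: "0 \<le> k' t" if "0 \<le> t" "t \<le> T" for t
    using DERIV_nonneg_imp_nondecreasing[OF that(1), of k'] k' nn that assms(6) by fastforce
  show ?thesis
    using DERIV_nonneg_imp_nondecreasing[OF assms(1), of k] k 1 assms(5) by fastforce
qed

text \<open>The function \<open>1 / sqrt q\<close> is 1-Lipschitz; the shift by \<open>e\<close> covers zeros of \<open>q\<close>.\<close>
lemma self_concordant_sqrt_le:
  fixes q q' :: "real \<Rightarrow> real"
  assumes "0 \<le> T"
    and q: "\<And>t. 0 \<le> t \<Longrightarrow> t \<le> T \<Longrightarrow> (q has_real_derivative q' t) (at t)"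
    and q0: "\<And>t. 0 \<le> t \<Longrightarrow> t \<le> T \<Longrightarrow> 0 \<le> q t"
    and q': "\<And>t. 0 \<le> t \<Longrightarrow> t \<le> T \<Longrightarrow> \<bar>q' t\<bar> \<le> 2 * q t powr (3/2)"
  shows "sqrt (q 0) \<le> sqrt (q T) * (1 + T * sqrt (q 0))"
    and "sqrt (q T) \<le> sqrt (q 0) * (1 + T * sqrt (q T))"
proof -
  have *: "sqrt (q 0 + e) \<le> sqrt (q T + e) * (1 + T * sqrt (q 0 + e)) \<and>
           sqrt (q T + e) \<le> sqrt (q 0 + e) * (1 + T * sqrt (q T + e))" if e: "e > 0" for e
  proof -
    define \<psi> where "\<psi> t = (q t + e) powr (-1/2)" for t
    have bound: "\<bar>\<psi> T - \<psi> 0\<bar> \<le> T"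
    proof (cases "T = 0")
      case False
      then have "0 < T" using assms(1) by simp
      have d: "(\<psi> has_real_derivative (-1/2) * (q t + e) powr (-1/2 - 1) * q' t) (at t)"
        if "0 \<le> t" "t \<le> T" for t
        unfolding \<psi>_def using q0[OF that] e
        by (auto intro!: derivative_eq_intros q that)
      obtain z where z: "0 < z" "z < T"
        "\<psi> T - \<psi> 0 = (T - 0) * ((-1/2) * (q z + e) powr (-1/2 - 1) * q' z)"
        using MVT2[OF \<open>0 < T\<close> d] by auto
      have p: "q z + e > 0" using q0[of z] z e by simp
      \<comment> \<open>The exponents \<open>-3/2\<close> and \<open>3/2\<close> cancel, so the
        slope of \<open>\<psi>\<close> is at most 1 in absolute value.\<close>
      have "\<bar>(-1/2) * (q z + e) powr (-1/2 - 1) * q' z\<bar> = (1/2) * (q z + e) powr (-3/2) * \<bar>q' z\<bar>"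
        by (simp add: abs_mult)
      also have "\<dots> \<le> (1/2) * (q z + e) powr (-3/2) * (2 * (q z + e) powr (3/2))"
      proof (rule mult_left_mono)
        have "q z powr (3/2) \<le> (q z + e) powr (3/2)"
          using q0[of z] z e by (intro powr_mono2) auto
        then show "\<bar>q' z\<bar> \<le> 2 * (q z + e) powr (3/2)" using q'[of z] z by simp
      qed simp
      also have "\<dots> = 1" using p by (simp add: powr_minus field_simps)
      finally have "\<bar>(-1/2) * (q z + e) powr (-1/2 - 1) * q' z\<bar> \<le> 1" .
      then show ?thesis
        unfolding z(3) abs_mult using \<open>0 < T\<close> by (simp add: mult_left_le abs_mult)
    qed simp
    have pos: "sqrt (q 0 + e) > 0" "sqrt (q T + e) > 0"
      using q0[of 0] q0[of T] assms(1) e by auto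
    have "\<psi> t = 1 / sqrt (q t + e)" if "0 \<le> t" "t \<le> T" for t
      using q0[OF that] e unfolding \<psi>_def by (simp add: powr_minus powr_half_sqrt field_simps)
    then have "\<bar>1 / sqrt (q T + e) - 1 / sqrt (q 0 + e)\<bar> \<le> T" using bound assms(1) by simp
    then have "1 / sqrt (q T + e) \<le> 1 / sqrt (q 0 + e) + T" "1 / sqrt (q 0 + e) \<le> 1 / sqrt (q T + e) + T"
      by linarith+
    then show ?thesis using pos by (simp add: field_simps)
  qed
  \<comment> \<open>The inequalities are multiplied out, without reciprocals, so they survive the
    limit \<open>e \<rightarrow> 0\<close> even where \<open>q\<close> vanishes at an end
    point.\<close>
  have ev: "\<forall>\<^sub>F e in at_right (0::real). 0 < e" by (simp add: eventually_at_right_less)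
  show "sqrt (q 0) \<le> sqrt (q T) * (1 + T * sqrt (q 0))"
  proof (rule tendsto_le[OF trivial_limit_at_right_real])
    show "((\<lambda>e. sqrt (q 0 + e)) \<longlongrightarrow> sqrt (q 0)) (at_right 0)"
      by (auto intro!: tendsto_eq_intros)
    show "((\<lambda>e. sqrt (q T + e) * (1 + T * sqrt (q 0 + e))) \<longlongrightarrow> sqrt (q T) * (1 + T * sqrt (q 0))) (at_right 0)"
      by (auto intro!: tendsto_eq_intros)
    show "\<forall>\<^sub>F e in at_right 0. sqrt (q 0 + e) \<le> sqrt (q T + e) * (1 + T * sqrt (q 0 + e))"
      using ev by eventually_elim (use * in blast)
  qed
  show "sqrt (q T) \<le> sqrt (q 0) * (1 + T * sqrt (q T))"
  proof (rule tendsto_le[OF trivial_limit_at_right_real])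
    show "((\<lambda>e. sqrt (q T + e)) \<longlongrightarrow> sqrt (q T)) (at_right 0)"
      by (auto intro!: tendsto_eq_intros)
    show "((\<lambda>e. sqrt (q 0 + e) * (1 + T * sqrt (q T + e))) \<longlongrightarrow> sqrt (q 0) * (1 + T * sqrt (q T))) (at_right 0)"
      by (auto intro!: tendsto_eq_intros)
    show "\<forall>\<^sub>F e in at_right 0. sqrt (q T + e) \<le> sqrt (q 0 + e) * (1 + T * sqrt (q T + e))"
      using ev by eventually_elim (use * in blast)
  qed
qed

text \<open>The square root estimates say
  \<open>D / (1 + t * D) \<le> sqrt (q t) \<le> D / (1 - t * D)\<close>, the upper one for
  \<open>D < 1\<close>. The squares of the outer terms are the second derivatives of
  \<open>t * D - ln (1 + t * D)\<close> and \<open>- t * D - ln (1 - t * D)\<close>, which vanish to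
  first order at 0; integrating twice gives both bounds.\<close>

lemma self_concordant_real_bounds:
  fixes \<phi> \<phi>' q q' :: "real \<Rightarrow> real"
  assumes \<phi>: "\<And>t. 0 \<le> t \<Longrightarrow> t \<le> 1 \<Longrightarrow> (\<phi> has_real_derivative \<phi>' t) (at t)"
    and \<phi>': "\<And>t. 0 \<le> t \<Longrightarrow> t \<le> 1 \<Longrightarrow> (\<phi>' has_real_derivative q t) (at t)"
    and q: "\<And>t. 0 \<le> t \<Longrightarrow> t \<le> 1 \<Longrightarrow> (q has_real_derivative q' t) (at t)"
    and q0: "\<And>t. 0 \<le> t \<Longrightarrow> t \<le> 1 \<Longrightarrow> 0 \<le> q t"
    and q': "\<And>t. 0 \<le> t \<Longrightarrow> t \<le> 1 \<Longrightarrow> \<bar>q' t\<bar> \<le> 2 * q t powr (3/2)"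
    and D: "D = sqrt (q 0)"
  shows "\<phi> 0 + \<phi>' 0 + (D - ln (1 + D)) \<le> \<phi> 1"
    and "D < 1 \<Longrightarrow> \<phi> 1 \<le> \<phi> 0 + \<phi>' 0 + (- D - ln (1 - D))"
proof -
  have D0: "0 \<le> D" using q0[of 0] D by simp
  have s: "D \<le> sqrt (q t) * (1 + t * D)" "sqrt (q t) \<le> D * (1 + t * sqrt (q t))"
    if "0 \<le> t" "t \<le> 1" for t
    unfolding D using self_concordant_sqrt_le[of t q q'] q q0 q' that by auto
  let ?k = "\<lambda>t. \<phi> t - \<phi> 0 - t * \<phi>' 0 - (t * D - ln (1 + t * D))"
  have "0 \<le> ?k 1"
  proof (rule second_derivative_nonneg_imp_nonneg[where k = ?k and T = 1 and
        k' = "\<lambda>t. \<phi>' t - \<phi>' 0 - (D - D / (1 + t * D))" and k'' = "\<lambda>t. q t - (D / (1 + t * D))\<^sup>2"])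
    fix t :: real assume t: "0 \<le> t" "t \<le> 1"
    have p: "1 + t * D > 0" using D0 t by (simp add: add_pos_nonneg)
    show "(?k has_real_derivative \<phi>' t - \<phi>' 0 - (D - D / (1 + t * D))) (at t)"
      using p by (auto intro!: derivative_eq_intros \<phi> t)
    show "((\<lambda>t. \<phi>' t - \<phi>' 0 - (D - D / (1 + t * D))) has_real_derivative q t - (D / (1 + t * D))\<^sup>2) (at t)"
      using p by (auto intro!: derivative_eq_intros \<phi>' t simp: power2_eq_square)
    have "D / (1 + t * D) \<le> sqrt (q t)" using s(1)[OF t] p by (simp add: divide_le_eq)
    then have "(D / (1 + t * D))\<^sup>2 \<le> (sqrt (q t))\<^sup>2" using p D0 by (intro power_mono) auto
    then show "0 \<le> q t - (D / (1 + t * D))\<^sup>2" using q0[OF t] by simp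
  qed auto
  then show "\<phi> 0 + \<phi>' 0 + (D - ln (1 + D)) \<le> \<phi> 1" by simp
  assume D1: "D < 1"
  let ?k = "\<lambda>t. \<phi> 0 + t * \<phi>' 0 + (- (t * D) - ln (1 - t * D)) - \<phi> t"
  have "0 \<le> ?k 1"
  proof (rule second_derivative_nonneg_imp_nonneg[where k = ?k and T = 1 and
        k' = "\<lambda>t. \<phi>' 0 + (- D + D / (1 - t * D)) - \<phi>' t" and k'' = "\<lambda>t. (D / (1 - t * D))\<^sup>2 - q t"])
    fix t :: real assume t: "0 \<le> t" "t \<le> 1"
    have "t * D \<le> 1 * D" using D0 t by (intro mult_right_mono) auto
    then have p: "1 - t * D > 0" using D1 by simp
    show "(?k has_real_derivative \<phi>' 0 + (- D + D / (1 - t * D)) - \<phi>' t) (at t)"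
      using p by (auto intro!: derivative_eq_intros \<phi> t)
    show "((\<lambda>t. \<phi>' 0 + (- D + D / (1 - t * D)) - \<phi>' t) has_real_derivative (D / (1 - t * D))\<^sup>2 - q t) (at t)"
      using p by (auto intro!: derivative_eq_intros \<phi>' t simp: power2_eq_square)
    have "sqrt (q t) \<le> D / (1 - t * D)" using s(2)[OF t] p by (simp add: le_divide_eq algebra_simps)
    then have "(sqrt (q t))\<^sup>2 \<le> (D / (1 - t * D))\<^sup>2" using q0[OF t] by (intro power_mono) auto
    then show "0 \<le> (D / (1 - t * D))\<^sup>2 - q t" using q0[OF t] by simp
  qed auto
  then show "\<phi> 1 \<le> \<phi> 0 + \<phi>' 0 + (- D - ln (1 - D))" by simp
qed

text \<open>The step size maximizes the guaranteed decrease \<open>\<gamma> G + \<gamma> D + ln (1 - \<gamma> D)\<close> over \<open>\<gamma> \<in> [0, 1]\<close>;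
  if it is not capped, the decrease is \<open>\<omega> (G / D)\<close> with \<open>\<omega> s = s - ln (1 + s)\<close>, otherwise at least \<open>G / 2\<close>.\<close>
lemma step_size_decrease:
  fixes G D M :: real
  assumes G: "0 \<le> G" and D: "0 \<le> D" and M: "1 \<le> M" and DM: "D \<le> G + M"
  defines "\<gamma> \<equiv> step_size G D"
  defines "dec \<equiv> \<gamma> * G + \<gamma> * D + ln (1 - \<gamma> * D)"
  shows "0 \<le> \<gamma>" "\<gamma> \<le> 1" "\<gamma> * D < 1" "G > M \<Longrightarrow> dec \<ge> 1 / 10.6" "G \<le> M \<Longrightarrow> dec \<ge> G\<^sup>2 / (12 * M\<^sup>2)"
proof -
  have small: "G\<^sup>2 / (12 * M\<^sup>2) \<le> s - ln (1 + s)" if "G \<le> M" "G / (G + M) \<le> s" for s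
  proof -
    let ?r = "G / (G + M)"
    have r: "0 \<le> ?r" "?r \<le> 1/2" using G M that by (auto simp: field_simps)
    have "G / (2 * M) \<le> ?r" using G M that by (intro divide_left_mono) auto
    then have "(G / (2 * M))\<^sup>2 \<le> ?r\<^sup>2" using G M by (intro power_mono) auto
    then have "G\<^sup>2 / (12 * M\<^sup>2) \<le> ?r\<^sup>2 / 3" by (simp add: power_divide power_mult_distrib)
    also have "\<dots> \<le> ?r - ln (1 + ?r)" by (rule ln_one_plus_le_quadratic[OF r])
    also have "\<dots> \<le> s - ln (1 + s)" by (rule sub_ln_one_plus_mono[OF r(1) that(2)])
    finally show ?thesis .
  qed
  \<comment> \<open>Used for \<open>D = 0\<close> and for the capped step. A decrease of
    \<open>G / 2\<close> suffices since \<open>1 \<le> M\<close>: it exceeds \<open>1/2\<close> if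
    \<open>G > M\<close>, and otherwise \<open>G\<^sup>2 \<le> M\<^sup>2 * G\<close>.\<close>
  have half: "(G > M \<longrightarrow> dec \<ge> 1 / 10.6) \<and> (G \<le> M \<longrightarrow> dec \<ge> G\<^sup>2 / (12 * M\<^sup>2))" if "G / 2 \<le> dec"
  proof (intro conjI impI)
    assume "G \<le> M"
    then have "G\<^sup>2 \<le> M * G" using G by (simp add: power2_eq_square mult_right_mono)
    also have "\<dots> \<le> M\<^sup>2 * G" using G M by (simp add: power2_eq_square mult_right_mono)
    finally have "G\<^sup>2 \<le> M\<^sup>2 * G" .
    moreover have "0 \<le> M\<^sup>2 * G" using G by simp
    ultimately have "G\<^sup>2 \<le> M\<^sup>2 * G * 6" by linarith
    then have "G\<^sup>2 / (12 * M\<^sup>2) \<le> G / 2" using M by (simp add: field_simps)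
    then show "dec \<ge> G\<^sup>2 / (12 * M\<^sup>2)" using that by simp
  qed (use that M in simp)
  have "0 \<le> \<gamma> \<and> \<gamma> \<le> 1 \<and> \<gamma> * D < 1 \<and> (G > M \<longrightarrow> dec \<ge> 1 / 10.6) \<and> (G \<le> M \<longrightarrow> dec \<ge> G\<^sup>2 / (12 * M\<^sup>2))"
  proof (cases "G = 0 \<or> D = 0")
    case True
    then show ?thesis
    proof
      assume "G = 0" then show ?thesis using M by (simp add: \<gamma>_def dec_def step_size_def)
    next
      assume "D = 0"
      then have "G / 2 \<le> dec" "\<gamma> = 0 \<or> \<gamma> = 1" using G by (auto simp: \<gamma>_def dec_def step_size_def)
      then show ?thesis using half \<open>D = 0\<close> by auto
    qed
  next
    case False
    then have pos: "G > 0" "D > 0" using G D by auto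
    show ?thesis
    proof (cases "G / (D * (D + G)) \<le> 1")
      case True
      then have g: "\<gamma> = G / (D * (D + G))" using pos by (simp add: \<gamma>_def step_size_def)
      have gD: "\<gamma> * D = G / (D + G)" using g pos by simp
      have one: "1 - G / (D + G) = inverse (1 + G / D)" using pos by (simp add: field_simps)
      have gg: "\<gamma> * G + \<gamma> * D = G / D" unfolding gD unfolding g using pos
        by (simp add: divide_simps) (simp add: algebra_simps)
      have "1 + G / D > 0" using pos by (simp add: add_pos_pos)
      then have dec: "dec = G / D - ln (1 + G / D)"
        unfolding dec_def gg unfolding gD one by (simp add: ln_inverse)
      \<comment> \<open>Here the bound on \<open>D\<close> enters: the argument of \<omega> is at
        least \<open>G / (G + M)\<close>, hence at least \<open>1/2\<close> if
        \<open>G > M\<close>.\<close>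
      have GD: "G / (G + M) \<le> G / D" using pos DM M by (intro divide_left_mono) auto
      have "dec \<ge> 1 / 10.6" if "G > M"
      proof -
        have "1 / 2 \<le> G / (G + M)" using that M by (simp add: field_simps)
        with GD have "1 / 2 \<le> G / D" by linarith
        from sub_ln_one_plus_mono[OF _ this] ln_three_halves_le dec show ?thesis by simp
      qed
      moreover have "dec \<ge> G\<^sup>2 / (12 * M\<^sup>2)" if "G \<le> M"
        using small[OF that GD] dec by simp
      ultimately show ?thesis using True g gD pos by auto
    next
      case no: False
      then have g: "\<gamma> = 1" using pos by (simp add: \<gamma>_def step_size_def)
      \<comment> \<open>The cap is active only if \<open>D * (D + G) \<le> G\<close>, that is
        \<open>D\<^sup>2 \<le> G * (1 - D)\<close>, and this forces \<open>D < 1\<close>.\<close>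
      have "0 < D * (D + G)" using pos by simp
      then have le: "D * (D + G) \<le> G" using no by (simp only: not_le less_divide_eq) simp
      then have "D\<^sup>2 \<le> G * (1 - D)" by (simp add: power2_eq_square algebra_simps)
      moreover have "0 < D\<^sup>2" using pos by simp
      ultimately have "0 < G * (1 - D)" by linarith
      then have D1: "D < 1" using pos by (simp add: zero_less_mult_iff)
      have "- D - ln (1 - D) \<le> D\<^sup>2 / (2 * (1 - D))" using D D1 by (rule neg_ln_one_minus_le)
      also have "\<dots> \<le> G / 2" using \<open>D\<^sup>2 \<le> G * (1 - D)\<close> D1 by (simp add: field_simps)
      finally have "G / 2 \<le> dec" using g by (simp add: dec_def)
      then show ?thesis using half g D1 by auto
    qed
  qed
  then show "0 \<le> \<gamma>" "\<gamma> \<le> 1" "\<gamma> * D < 1" "G > M \<Longrightarrow> dec \<ge> 1 / 10.6" "G \<le> M \<Longrightarrow> dec \<ge> G\<^sup>2 / (12 * M\<^sup>2)"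
    by blast+
qed

subsection \<open>Logarithmically homogeneous self-concordant barriers\<close>

lemma grad_has_derivative:
  fixes f :: "'b::euclidean_space \<Rightarrow> real"
  assumes "f differentiable (at w)"
  shows "(f has_derivative (\<lambda>v. grad f w \<bullet> v)) (at w)"
proof -
  let ?F = "frechet_derivative f (at w)"
  have l: "linear ?F" using assms by (rule linear_frechet_derivative)
  have "grad f w \<bullet> v = ?F v" for v
  proof -
    have "?F v = ?F (\<Sum>b\<in>Basis. (v \<bullet> b) *\<^sub>R b)" by (simp add: euclidean_representation)
    also have "\<dots> = (\<Sum>b\<in>Basis. (v \<bullet> b) * ?F b)"
      by (simp add: linear_sum[OF l] linear_cmul[OF l])
    also have "\<dots> = grad f w \<bullet> v"
      by (simp add: grad_def inner_sum_left inner_commute[of v] mult.commute)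
    finally show ?thesis by simp
  qed
  then have "(\<lambda>v. grad f w \<bullet> v) = ?F" by auto
  then show ?thesis using assms by (simp add: frechet_derivative_works)
qed

lemma line_has_derivative:
  "((\<lambda>t::real. w + t *\<^sub>R v) has_derivative (\<lambda>s. s *\<^sub>R v)) F"
  for w v :: "'b::real_normed_vector"
  by (auto intro!: derivative_eq_intros)

locale sc_barrier =
  fixes K :: "'b::euclidean_space set" and \<theta> :: real and f :: "'b \<Rightarrow> real"
  assumes proper: "proper_cone K" and barrier: "self_concordant_lh_barrier K \<theta> f"
begin

lemma convex_interior: "convex (interior K)"
  using barrier by (simp add: self_concordant_lh_barrier_def strictly_convex_on_def)

lemma strictly_convex:
  "x \<in> interior K \<Longrightarrow> y \<in> interior K \<Longrightarrow> x \<noteq> y \<Longrightarrow> 0 < s \<Longrightarrow> s < 1 \<Longrightarrow>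
    f ((1 - s) *\<^sub>R x + s *\<^sub>R y) < (1 - s) * f x + s * f y"
  using barrier by (simp add: self_concordant_lh_barrier_def strictly_convex_on_def)

lemma homogeneous: "w \<in> interior K \<Longrightarrow> c > 0 \<Longrightarrow> f (c *\<^sub>R w) = f w - \<theta> * ln c"
  using barrier by (simp add: self_concordant_lh_barrier_def)

lemma interior_scale:
  assumes w: "w \<in> interior K" and c: "c > 0"
  shows "c *\<^sub>R w \<in> interior K"
proof -
  have "open ((\<lambda>x. c *\<^sub>R x) ` interior K)" using c by (intro open_scaling) auto
  moreover have "(\<lambda>x. c *\<^sub>R x) ` interior K \<subseteq> K"
    using proper c interior_subset[of K] by (auto simp: proper_cone_def cone_def)
  ultimately show ?thesis using interior_maximal w by blast
qed

text \<open>A ball around 0 would contain a nonzero vector together with its negative, against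
  pointedness. This later makes \<open>w\<close>, \<open>2 w\<close> and \<open>u\<close>,
  \<open>u + w\<close> distinct, as strict convexity requires.\<close>

lemma zero_notin_interior: "0 \<notin> interior K"
proof
  assume "0 \<in> interior K"
  then obtain e where e: "e > 0" "cball 0 e \<subseteq> K" by (meson mem_interior_cball)
  obtain b :: 'b where b: "b \<in> Basis" using nonempty_Basis by blast
  then have "e *\<^sub>R b \<in> K" "- (e *\<^sub>R b) \<in> K" using e by auto
  then have "e *\<^sub>R b = 0" using proper by (auto simp: proper_cone_def)
  then show False using e b by auto
qed

lemma f_derivative: "w \<in> interior K \<Longrightarrow> (f has_derivative (\<lambda>v. grad f w \<bullet> v)) (at w)"
  using barrier differentiable_on_eq_differentiable_at[OF open_interior, of f K]
  by (auto simp: self_concordant_lh_barrier_def C3_on_def intro!: grad_has_derivative)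

lemma grad_derivative: "w \<in> interior K \<Longrightarrow> (grad f has_derivative hess f w) (at w)"
  using barrier differentiable_on_eq_differentiable_at[OF open_interior, of "grad f" K]
  by (auto simp: self_concordant_lh_barrier_def C3_on_def hess_def[abs_def] frechet_derivative_works)

lemma linear_hess: "w \<in> interior K \<Longrightarrow> linear (hess f w)"
  using grad_derivative has_derivative_linear by blast

lemma hess_derivative:
  "w \<in> interior K \<Longrightarrow> ((\<lambda>y. hess f y u) has_derivative frechet_derivative (\<lambda>y. hess f y u) (at w)) (at w)"
  using barrier differentiable_on_eq_differentiable_at[OF open_interior, of "\<lambda>y. hess f y u" K]
  by (auto simp: self_concordant_lh_barrier_def C3_on_def frechet_derivative_works)

lemma third_deriv_bound:
  "w \<in> interior K \<Longrightarrow> \<bar>third_deriv f w u u u\<bar> \<le> 2 * (u \<bullet> hess f w u) powr (3/2)"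
  using barrier by (simp add: self_concordant_lh_barrier_def)

text \<open>Self-concordance is used only through restrictions to lines. The second claim keeps a
  separate test vector \<open>u\<close> because \<open>hess_self\<close> differentiates the gradient
  along a ray against arbitrary vectors.\<close>

lemma line_derivatives:
  assumes "w + t *\<^sub>R v \<in> interior K"
  shows "((\<lambda>t. f (w + t *\<^sub>R v)) has_real_derivative grad f (w + t *\<^sub>R v) \<bullet> v) (at t)"
    and "((\<lambda>t. grad f (w + t *\<^sub>R v) \<bullet> u) has_real_derivative u \<bullet> hess f (w + t *\<^sub>R v) v) (at t)"
    and "((\<lambda>t. v \<bullet> hess f (w + t *\<^sub>R v) v) has_real_derivative third_deriv f (w + t *\<^sub>R v) v v v) (at t)"
proof -
  note L = line_has_derivative[of w v]
  show "((\<lambda>t. f (w + t *\<^sub>R v)) has_real_derivative grad f (w + t *\<^sub>R v) \<bullet> v) (at t)"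
    by (rule has_derivative_imp_has_field_derivative[OF has_derivative_compose[OF L f_derivative[OF assms]]]) simp
  have "((\<lambda>t. grad f (w + t *\<^sub>R v) \<bullet> u) has_derivative (\<lambda>s. hess f (w + t *\<^sub>R v) (s *\<^sub>R v) \<bullet> u)) (at t)"
    by (rule has_derivative_inner_left[OF has_derivative_compose[OF L grad_derivative[OF assms]]])
  then show "((\<lambda>t. grad f (w + t *\<^sub>R v) \<bullet> u) has_real_derivative u \<bullet> hess f (w + t *\<^sub>R v) v) (at t)"
    by (rule has_derivative_imp_has_field_derivative)
      (simp add: linear_cmul[OF linear_hess[OF assms]] inner_commute)
  let ?T = "frechet_derivative (\<lambda>y. hess f y v) (at (w + t *\<^sub>R v))"
  have "linear ?T" using hess_derivative[OF assms] has_derivative_linear by blast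
  have "((\<lambda>t. v \<bullet> hess f (w + t *\<^sub>R v) v) has_derivative (\<lambda>s. v \<bullet> ?T (s *\<^sub>R v))) (at t)"
    by (rule has_derivative_inner_right[OF has_derivative_compose[OF L hess_derivative[OF assms]]])
  then show "((\<lambda>t. v \<bullet> hess f (w + t *\<^sub>R v) v) has_real_derivative third_deriv f (w + t *\<^sub>R v) v v v) (at t)"
    by (rule has_derivative_imp_has_field_derivative)
      (simp add: linear_cmul[OF \<open>linear ?T\<close>] third_deriv_def inner_commute)
qed

text \<open>The restriction of \<open>f\<close> to a line is convex, so its derivative is monotone,
  and the quadratic form is the derivative of that monotone function at 0.\<close>

lemma hess_nonneg:
  assumes w: "w \<in> interior K"
  shows "0 \<le> v \<bullet> hess f w v"
proof -
  let ?S = "{t::real. w + t *\<^sub>R v \<in> interior K}"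
  have "?S = (\<lambda>t. w + t *\<^sub>R v) -` interior K" by auto
  then have opn: "open ?S" by (auto intro!: open_vimage continuous_intros)
  have comb: "w + ((1 - u) * a + u * b) *\<^sub>R v = (1 - u) *\<^sub>R (w + a *\<^sub>R v) + u *\<^sub>R (w + b *\<^sub>R v)" for a b u :: real
    by (simp add: algebra_simps)
  have cS: "convex ?S"
    unfolding convex_alt using convexD_alt[OF convex_interior] by (auto simp: comb)
  have cf: "convex_on ?S (\<lambda>t. f (w + t *\<^sub>R v))"
  proof (rule convex_onI[OF _ cS])
    fix u a b :: real assume u: "0 < u" "u < 1" and ab: "a \<in> ?S" "b \<in> ?S"
    \<comment> \<open>Strict convexity speaks of distinct points only, so coinciding points
      (\<open>v = 0\<close> or \<open>a = b\<close>) are treated apart.\<close>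
    show "f (w + ((1 - u) *\<^sub>R a + u *\<^sub>R b) *\<^sub>R v) \<le> (1 - u) * f (w + a *\<^sub>R v) + u * f (w + b *\<^sub>R v)"
    proof (cases "w + a *\<^sub>R v = w + b *\<^sub>R v")
      case True
      then have eq: "w + ((1 - u) *\<^sub>R a + u *\<^sub>R b) *\<^sub>R v = w + b *\<^sub>R v"
        unfolding real_scaleR_def comb[of u a b] True by (simp add: scaleR_left_distrib[symmetric])
      have "(1 - u) * y + u * y = y" for y :: real by (simp add: algebra_simps)
      then show ?thesis unfolding eq True by simp
    next
      case False
      then show ?thesis using strictly_convex[of "w + a *\<^sub>R v" "w + b *\<^sub>R v" u] u ab comb[of u a b] by simp
    qed
  qed
  have tangent: "(grad f (w + a *\<^sub>R v) \<bullet> v) * (b - a) \<le> f (w + b *\<^sub>R v) - f (w + a *\<^sub>R v)"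
    if "a \<in> ?S" "b \<in> ?S" for a b
    using convex_on_imp_above_tangent[OF cf convex_connected[OF cS], of a b "grad f (w + a *\<^sub>R v) \<bullet> v"]
      has_field_derivative_at_within[OF line_derivatives(1)[of w a v]] that interior_open[OF opn] by simp
  have "mono_on ?S (\<lambda>t. grad f (w + t *\<^sub>R v) \<bullet> v)"
  proof (rule mono_onI)
    fix a b assume ab: "a \<in> ?S" "b \<in> ?S" "a \<le> b"
    \<comment> \<open>The sum of the tangent inequalities at \<open>a\<close> and at
      \<open>b\<close>.\<close>
    have "0 \<le> (b - a) * (grad f (w + b *\<^sub>R v) \<bullet> v - grad f (w + a *\<^sub>R v) \<bullet> v)"
      using tangent[of a b] tangent[of b a] ab by (simp add: algebra_simps)
    then show "grad f (w + a *\<^sub>R v) \<bullet> v \<le> grad f (w + b *\<^sub>R v) \<bullet> v"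
      using ab by (cases "a = b") (auto simp: zero_le_mult_iff)
  qed
  from mono_on_imp_deriv_nonneg[OF this line_derivatives(2)[of w 0 v v]] show ?thesis
    using w interior_open[OF opn] by simp
qed

lemma local_norm_nonneg: "w \<in> interior K \<Longrightarrow> 0 \<le> local_norm f w v"
  using hess_nonneg by (simp add: local_norm_def)

lemma local_norm_scale:
  "w \<in> interior K \<Longrightarrow> 0 \<le> c \<Longrightarrow> local_norm f w (c *\<^sub>R v) = c * local_norm f w v"
  by (simp add: local_norm_def linear_cmul[OF linear_hess] real_sqrt_mult mult.assoc[symmetric])

lemma self_concordant_bounds:
  assumes w: "w \<in> interior K" "w + v \<in> interior K"
  defines "D \<equiv> local_norm f w v"
  shows "f w + grad f w \<bullet> v + (D - ln (1 + D)) \<le> f (w + v)"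
    and "D < 1 \<Longrightarrow> f (w + v) \<le> f w + grad f w \<bullet> v + (- D - ln (1 - D))"
proof -
  have seg: "w + t *\<^sub>R v \<in> interior K" if "0 \<le> t" "t \<le> 1" for t
    using convexD_alt[OF convex_interior w that] by (simp add: algebra_simps)
  have D: "D = sqrt (v \<bullet> hess f (w + 0 *\<^sub>R v) v)" by (simp add: D_def local_norm_def)
  note bounds = self_concordant_real_bounds[where \<phi> = "\<lambda>t. f (w + t *\<^sub>R v)"
      and \<phi>' = "\<lambda>t. grad f (w + t *\<^sub>R v) \<bullet> v" and q = "\<lambda>t. v \<bullet> hess f (w + t *\<^sub>R v) v"
      and q' = "\<lambda>t. third_deriv f (w + t *\<^sub>R v) v v v" and D = D]
  have "f (w + 0 *\<^sub>R v) + grad f (w + 0 *\<^sub>R v) \<bullet> v + (D - ln (1 + D)) \<le> f (w + 1 *\<^sub>R v)"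
    by (rule bounds(1)) (rule line_derivatives seg hess_nonneg third_deriv_bound D | assumption)+
  then show "f w + grad f w \<bullet> v + (D - ln (1 + D)) \<le> f (w + v)" by simp
  assume D1: "D < 1"
  have "f (w + 1 *\<^sub>R v) \<le> f (w + 0 *\<^sub>R v) + grad f (w + 0 *\<^sub>R v) \<bullet> v + (- D - ln (1 - D))"
    by (rule bounds(2)) (rule line_derivatives seg hess_nonneg third_deriv_bound D D1 | assumption)+
  then show "f (w + v) \<le> f w + grad f w \<bullet> v + (- D - ln (1 - D))" by simp
qed

lemma tangent_below:
  assumes "w \<in> interior K" "y \<in> interior K"
  shows "f w + grad f w \<bullet> (y - w) \<le> f y"
  using self_concordant_bounds(1)[of w "y - w"] assms local_norm_nonneg[of w "y - w"]
    ln_add_one_self_le_self[of "local_norm f w (y - w)"] by simp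

section \<open>Identities from logarithmic homogeneity\<close>

lemma grad_scale:
  assumes w: "w \<in> interior K" and c: "c > 0"
  shows "grad f (c *\<^sub>R w) = (1 / c) *\<^sub>R grad f w"
proof -
  have "((\<lambda>y. f (c *\<^sub>R y)) has_derivative (\<lambda>v. grad f (c *\<^sub>R w) \<bullet> (c *\<^sub>R v))) (at w)"
    by (rule has_derivative_compose[of "\<lambda>y. c *\<^sub>R y" "\<lambda>v. c *\<^sub>R v" w UNIV f,
          OF _ f_derivative[OF interior_scale[OF w c]]])
      (auto intro!: derivative_eq_intros)
  moreover have "((\<lambda>y. f (c *\<^sub>R y)) has_derivative (\<lambda>v. grad f w \<bullet> v)) (at w)"
  proof (rule has_derivative_transform_within_open[OF _ open_interior w])
    show "((\<lambda>y. f y - \<theta> * ln c) has_derivative (\<lambda>v. grad f w \<bullet> v)) (at w)"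
      using f_derivative[OF w] by (auto intro!: derivative_eq_intros)
  qed (simp add: homogeneous c)
  ultimately have "(\<lambda>v. grad f (c *\<^sub>R w) \<bullet> (c *\<^sub>R v)) = (\<lambda>v. grad f w \<bullet> v)"
    by (rule has_derivative_unique)
  then have "\<forall>v. (c *\<^sub>R grad f (c *\<^sub>R w)) \<bullet> v = grad f w \<bullet> v" by (simp add: fun_eq_iff)
  then have "c *\<^sub>R grad f (c *\<^sub>R w) = grad f w" by (simp only: vector_eq_rdot)
  from arg_cong[OF this, of "\<lambda>y. (1 / c) *\<^sub>R y"] show ?thesis using c by simp
qed

lemma ray_eq: "w + t *\<^sub>R w = (1 + t) *\<^sub>R w" for w :: 'b and t :: real
  by (simp add: algebra_simps)

lemma grad_self:
  assumes w: "w \<in> interior K"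
  shows "grad f w \<bullet> w = - \<theta>"
proof -
  have "((\<lambda>t. f (w + t *\<^sub>R w)) has_real_derivative - \<theta>) (at 0)"
  proof (rule has_field_derivative_transform_within_open[of "\<lambda>t. f w - \<theta> * ln (1 + t)" _ _ "{-1<..}"])
    show "((\<lambda>t. f w - \<theta> * ln (1 + t)) has_real_derivative - \<theta>) (at 0)"
      by (auto intro!: derivative_eq_intros)
  qed (use w in \<open>auto simp: ray_eq homogeneous\<close>)
  from DERIV_unique[OF this line_derivatives(1)] show ?thesis using w by simp
qed

text \<open>By \<open>grad_scale\<close> the gradient along the ray through \<open>w\<close> is
  \<open>grad f w / (1 + t)\<close>; the identity is its derivative at \<open>t = 0\<close>.\<close>

lemma hess_self:
  assumes w: "w \<in> interior K"
  shows "u \<bullet> hess f w w = - (grad f w \<bullet> u)"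
proof -
  have "((\<lambda>t. grad f (w + t *\<^sub>R w) \<bullet> u) has_real_derivative - (grad f w \<bullet> u)) (at 0)"
  proof (rule has_field_derivative_transform_within_open[of "\<lambda>t. (grad f w \<bullet> u) / (1 + t)" _ _ "{-1<..}"])
    show "((\<lambda>t. (grad f w \<bullet> u) / (1 + t)) has_real_derivative - (grad f w \<bullet> u)) (at 0)"
      by (auto intro!: derivative_eq_intros)
  qed (use w in \<open>auto simp: ray_eq grad_scale\<close>)
  from DERIV_unique[OF this line_derivatives(2)] show ?thesis using w by simp
qed

text \<open>The product rule applied to the constant function
  \<open>grad f y \<bullet> y = - \<theta>\<close>. Together with \<open>hess_self\<close> it
  evaluates both cross terms in \<open>local_norm_diff_sq\<close>.\<close>

lemma self_hess:
  assumes w: "w \<in> interior K"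
  shows "w \<bullet> hess f w u = - (grad f w \<bullet> u)"
proof -
  have "((\<lambda>y. grad f y \<bullet> y) has_derivative (\<lambda>v. grad f w \<bullet> v + hess f w v \<bullet> w)) (at w)"
    by (rule has_derivative_inner[OF grad_derivative[OF w] has_derivative_ident])
  moreover have "((\<lambda>y. grad f y \<bullet> y) has_derivative (\<lambda>v. 0)) (at w)"
    by (rule has_derivative_transform_within_open[OF has_derivative_const[of "- \<theta>"] open_interior w])
      (simp add: grad_self)
  ultimately have "(\<lambda>v. grad f w \<bullet> v + hess f w v \<bullet> w) = (\<lambda>v. 0)" by (rule has_derivative_unique)
  then have "grad f w \<bullet> u + hess f w u \<bullet> w = 0" by metis
  then show ?thesis by (simp add: inner_commute)
qed

text \<open>In the direction \<open>w\<close> itself the second derivative is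
  \<open>\<theta>\<close> and the third is \<open>- 2 * \<theta>\<close>, so self-concordance reads
  \<open>2 * \<theta> \<le> 2 * \<theta> powr (3/2)\<close>. For \<open>\<theta> > 0\<close> this
  means \<open>1 \<le> \<theta>\<close>.\<close>

lemma theta_ge_1:
  assumes w: "w \<in> interior K"
  shows "1 \<le> \<theta>"
proof -
  have h: "w \<bullet> hess f w w = \<theta>" if "w \<in> interior K" for w
    using hess_self[OF that, of w] grad_self[OF that] by simp
  have scaled: "w \<bullet> hess f (w + t *\<^sub>R w) w = \<theta> / (1 + t)\<^sup>2" if t: "t > -1" for t
  proof -
    have i: "(1 + t) *\<^sub>R w \<in> interior K" using w t by (intro interior_scale) auto
    from h[OF i] have "(1 + t)\<^sup>2 * (w \<bullet> hess f ((1 + t) *\<^sub>R w) w) = \<theta>"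
      by (simp add: linear_cmul[OF linear_hess[OF i]] power2_eq_square mult.assoc)
    then have "w \<bullet> hess f ((1 + t) *\<^sub>R w) w = \<theta> / (1 + t)\<^sup>2"
      using t by (intro eq_divide_imp) (auto simp: mult.commute)
    then show ?thesis by (simp only: ray_eq)
  qed
  have "((\<lambda>t. w \<bullet> hess f (w + t *\<^sub>R w) w) has_real_derivative - 2 * \<theta>) (at 0)"
  proof (rule has_field_derivative_transform_within_open[of "\<lambda>t. \<theta> / (1 + t)\<^sup>2" _ _ "{-1<..}"])
    show "((\<lambda>t. \<theta> / (1 + t)\<^sup>2) has_real_derivative - 2 * \<theta>) (at 0)"
      by (auto intro!: derivative_eq_intros)
  qed (auto simp: scaled)
  from DERIV_unique[OF this line_derivatives(3)] have "third_deriv f w w w w = - 2 * \<theta>" using w by simp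
  with third_deriv_bound[OF w, of w] h[OF w] have b: "2 * \<bar>\<theta>\<bar> \<le> 2 * \<theta> powr (3/2)" by (simp add: abs_mult)
  have "0 \<le> \<theta>" using hess_nonneg[OF w, of w] h[OF w] by simp
  \<comment> \<open>With \<open>\<theta> = 0\<close> the barrier would be constant along rays,
    contradicting strict convexity between \<open>w\<close> and \<open>2 w\<close>, whose midpoint
    is \<open>(3/2) w\<close>.\<close>
  moreover have "\<theta> \<noteq> 0"
  proof
    assume z: "\<theta> = 0"
    have i: "2 *\<^sub>R w \<in> interior K" "(3/2) *\<^sub>R w \<in> interior K" using w by (auto intro: interior_scale)
    have "w \<noteq> 2 *\<^sub>R w" using w zero_notin_interior by (auto simp: scaleR_2)
    from strictly_convex[OF w i(1) this, of "1/2"]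
    have "f ((1/2) *\<^sub>R w + w) < f w" using homogeneous[OF w, of 2] z
      by simp
    moreover have "(1/2) *\<^sub>R w + w = (3/2) *\<^sub>R w" using scaleR_left_distrib[of "1/2" 1 w] by simp
    ultimately show False using homogeneous[OF w, of "3/2"] z by simp
  qed
  ultimately have pos: "\<theta> > 0" by simp
  have "\<theta> powr (3/2) = \<theta> * sqrt \<theta>" using pos
    by (simp add: powr_half_sqrt[symmetric] powr_mult_base)
  with b pos have "\<theta> * 1 \<le> \<theta> * sqrt \<theta>" by simp
  then show ?thesis using pos by (simp only: mult_le_cancel_left_pos real_le_rsqrt real_sqrt_ge_1_iff)
qed

text \<open>Otherwise the lower bound for \<open>f (w + s u)\<close> grows linearly in \<open>s\<close>, whereas
  \<open>f (w + s u) = f (u + w / s) - \<theta> ln s\<close> is bounded above.\<close>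
lemma local_norm_le_neg_grad:
  assumes w: "w \<in> interior K" and u: "u \<in> interior K"
  shows "local_norm f w u \<le> - (grad f w \<bullet> u)"
proof (rule ccontr)
  define r where "r = local_norm f w u"
  define a where "a = r + grad f w \<bullet> u"
  \<comment> \<open>The logarithm will be bounded by its tangent at \<open>k\<close>, whose slope
    \<open>1 / k\<close> turns \<open>s * r\<close> into at most half of the linear term
    \<open>s * a\<close>. Writing \<open>r + 1\<close> keeps \<open>k\<close> positive when
    \<open>r = 0\<close>.\<close>
  define k where "k = 2 * (r + 1) / a"
  define C where "C = max (f u) (f (u + w))"
  assume "\<not> ?thesis"
  then have a: "a > 0" by (simp add: a_def r_def)
  have r: "0 \<le> r" using local_norm_nonneg[OF w] by (simp add: r_def)
  have k: "k > 0" using a r by (simp add: k_def)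
  have add_interior: "u + c *\<^sub>R w \<in> interior K" if "c > 0" for c
  proof -
    have "2 *\<^sub>R ((1 - 1/2) *\<^sub>R u + (1/2) *\<^sub>R (c *\<^sub>R w)) \<in> interior K"
      using that u w by (intro interior_scale convexD_alt[OF convex_interior]) auto
    then show ?thesis by (simp add: scaleR_right_distrib)
  qed
  have bound: "s * (a / 2) \<le> C - f w + 1 / k - 1 + ln k" if s: "s > 1" for s
  proof -
    have ws: "w + s *\<^sub>R u = s *\<^sub>R (u + (1 / s) *\<^sub>R w)" using s by (simp add: scaleR_right_distrib)
    have i: "u + (1 / s) *\<^sub>R w \<in> interior K" using s by (intro add_interior) auto
    have "f w + grad f w \<bullet> (s *\<^sub>R u) + (s * r - ln (1 + s * r)) \<le> f (w + s *\<^sub>R u)"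
      using self_concordant_bounds(1)[OF w, of "s *\<^sub>R u"] interior_scale[OF i, of s] s w
      by (simp add: ws[symmetric] local_norm_scale r_def)
    also have "\<dots> = f (u + (1 / s) *\<^sub>R w) - \<theta> * ln s"
      using homogeneous[OF i, of s] s by (simp add: ws)
    also have "\<dots> \<le> f (u + (1 / s) *\<^sub>R w)"
      using theta_ge_1[OF w] s by simp
    \<comment> \<open>As \<open>s > 1\<close>, this point lies between \<open>u\<close> and
      \<open>u + w\<close>, so convexity bounds \<open>f\<close> there by \<open>C\<close>,
      uniformly in \<open>s\<close>.\<close>
    also have "u + (1 / s) *\<^sub>R w = (1 - 1 / s) *\<^sub>R u + (1 / s) *\<^sub>R (u + w)"
      by (simp add: algebra_simps)
    also have "f \<dots> \<le> (1 - 1 / s) * f u + (1 / s) * f (u + w)"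
      using s w zero_notin_interior add_interior[of 1] by (intro less_imp_le strictly_convex u) auto
    also have "\<dots> \<le> (1 - 1 / s) * C + (1 / s) * C"
      using s by (intro add_mono mult_left_mono) (auto simp: C_def)
    also have "\<dots> = C" by (simp add: algebra_simps)
    finally have 1: "f w + s * a - ln (1 + s * r) \<le> C" by (simp add: a_def algebra_simps)
    have pos: "1 + s * r > 0" using s r by (simp add: add_pos_nonneg)
    have "ln ((1 + s * r) / k) \<le> (1 + s * r) / k - 1" using pos k by (intro ln_le_minus_one) auto
    then have 2: "ln (1 + s * r) \<le> 1 / k + s * r / k - 1 + ln k"
      unfolding ln_divide_pos[OF pos k] by (simp add: add_divide_distrib)
    have "r / k \<le> a / 2" using a r by (simp add: k_def field_simps)
    then have "s * (r / k) \<le> s * (a / 2)" using s by (intro mult_left_mono) auto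
    then have "s * r / k + s * (a / 2) \<le> s * a" by (simp add: field_simps)
    with 1 2 show ?thesis by linarith
  qed
  define c where "c = C - f w + 1 / k - 1 + ln k"
  \<comment> \<open>This \<open>s\<close> makes the left-hand side equal to
    \<open>a + \<bar>c\<bar>\<close>, which exceeds \<open>c\<close>.\<close>
  have "(2 + 2 * \<bar>c\<bar> / a) * (a / 2) \<le> c"
    using bound[of "2 + 2 * \<bar>c\<bar> / a"] a by (simp add: c_def add_pos_nonneg)
  then have "a + \<bar>c\<bar> \<le> c" using a by (simp add: distrib_right)
  then show False using a by linarith
qed

lemma local_norm_diff_sq:
  assumes w: "w \<in> interior K"
  shows "(local_norm f w (u - w))\<^sup>2 = (local_norm f w u)\<^sup>2 + 2 * (grad f w \<bullet> u) + \<theta>"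
proof -
  have "(u - w) \<bullet> hess f w (u - w) = u \<bullet> hess f w u + 2 * (grad f w \<bullet> u) + \<theta>"
    using hess_self[OF w, of u] hess_self[OF w, of w] self_hess[OF w, of u] grad_self[OF w]
    by (simp add: linear_diff[OF linear_hess[OF w]] inner_diff_left inner_diff_right)
  then show ?thesis using hess_nonneg[OF w, of u] hess_nonneg[OF w, of "u - w"] by (simp add: local_norm_def)
qed

text \<open>With \<open>p = - (grad f w \<bullet> u)\<close>, the norm of \<open>u\<close> is at
  most \<open>p\<close>, so the squared norm of \<open>u - w\<close> is at most
  \<open>p\<^sup>2 - 2 * p + \<theta>\<close>. If \<open>q + p \<ge> 2\<close>, comparison with
  \<open>q\<^sup>2\<close> uses \<open>(q - p) * (q + p - 2) \<ge> 0\<close>; otherwise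
  \<open>p < 1\<close>, and then \<open>p\<^sup>2 \<le> 2 * p\<close> and
  \<open>\<theta> \<le> q\<^sup>2\<close> suffice.\<close>

lemma local_norm_diff_le:
  assumes w: "w \<in> interior K" and u: "u \<in> interior K" and q: "- (grad f w \<bullet> u) \<le> q" "\<theta> \<le> q"
  shows "local_norm f w (u - w) \<le> q"
proof -
  define p where "p = - (grad f w \<bullet> u)"
  have th: "1 \<le> \<theta>" using theta_ge_1[OF w] .
  have n: "0 \<le> local_norm f w u" "local_norm f w u \<le> p"
    using local_norm_nonneg[OF w] local_norm_le_neg_grad[OF w u] by (auto simp: p_def)
  then have "(local_norm f w u)\<^sup>2 \<le> p\<^sup>2" by (intro power_mono) auto
  then have "(local_norm f w (u - w))\<^sup>2 \<le> p\<^sup>2 - 2 * p + \<theta>"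
    by (simp add: local_norm_diff_sq[OF w] p_def)
  also have "\<dots> \<le> q\<^sup>2"
  proof -
    have "p * p - 2 * p + \<theta> \<le> q * q"
    proof (cases "2 \<le> q + p")
      case True
      then have "0 \<le> (q - p) * (q + p - 2)" using q by (intro mult_nonneg_nonneg) (auto simp: p_def)
      also have "\<dots> = q * q - p * p - 2 * q + 2 * p" by algebra
      finally show ?thesis using q th by linarith
    next
      case False
      then have "p * p \<le> 2 * p" using q th n by (intro mult_right_mono) auto
      moreover have "\<theta> \<le> q * q" using mult_mono[of 1 q \<theta> q] q th by simp
      ultimately show ?thesis by linarith
    qed
    then show ?thesis by (simp add: power2_eq_square)
  qed
  finally show ?thesis by (rule power2_le_imp_le) (use th q in linarith)
qed

end

subsection \<open>Counting iterations\<close>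

text \<open>Applied below with the potentials \<open>- \<Delta>\<close>,
  \<open>1 / max \<Delta> e\<close> and \<open>- min \<Delta> \<epsilon>\<close>.\<close>

lemma potential_card_le:
  fixes P :: "nat \<Rightarrow> real"
  assumes "\<And>t. P t \<le> P (Suc t)" "\<And>t. t \<in> S \<Longrightarrow> P t + c \<le> P (Suc t)"
  shows "c * card (S \<inter> {..<n}) \<le> P n - P 0"
proof (induction n)
  case (Suc n)
  show ?case
  proof (cases "n \<in> S")
    case True
    then have "card (S \<inter> {..<Suc n}) = Suc (card (S \<inter> {..<n}))"
      by (simp add: lessThan_Suc Int_insert_right)
    then show ?thesis using Suc assms(2)[OF True] by (simp add: algebra_simps)
  next
    case False
    then show ?thesis using Suc assms(1)[of n] by (simp add: lessThan_Suc Int_insert_right)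
  qed
qed simp

text \<open>Steps with \<open>G t > M\<close> are counted by the decrease of \<open>\<Delta>\<close> itself. Among the other steps after \<open>K\<^sub>q\<close>,
  those with \<open>\<Delta> t > \<epsilon>\<close> have \<open>G t \<ge> \<Delta> t / 2\<close> and are counted by the growth of \<open>1 / \<Delta>\<close> (truncated so that
  the last such step counts in full), and those with \<open>\<Delta> t \<le> \<epsilon> < G t\<close> by the decrease of \<open>min \<Delta> \<epsilon>\<close>.\<close>
lemma descent_complexity:
  fixes \<Delta> G \<delta> :: "nat \<Rightarrow> real" and M \<epsilon> :: real and K\<^sub>r K\<^sub>s :: int
  assumes M: "0 < M" and \<epsilon>: "0 < \<epsilon>"
    and \<Delta>0: "\<And>t. 0 \<le> \<Delta> t"
    and large: "\<And>t. G t > M \<Longrightarrow> \<Delta> (Suc t) \<le> \<Delta> t - 1 / 10.6"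
    and small: "\<And>t. G t \<le> M \<Longrightarrow> \<Delta> (Suc t) \<le> \<Delta> t - (G t)\<^sup>2 / (12 * M\<^sup>2)"
    and gap: "\<And>t. G t \<le> M \<Longrightarrow> \<Delta> t \<le> G t + \<delta> t"
    and Kq: "1 \<le> K\<^sub>q" "\<And>t. K\<^sub>q \<le> t \<Longrightarrow> \<delta> t \<le> \<epsilon> / 2"
    and Kr: "K\<^sub>r = \<lfloor>10.6 * \<Delta> 0\<rfloor>"
    and Ks: "K\<^sub>s = \<lceil>48 * M\<^sup>2 / \<epsilon>\<rceil>"
  shows "\<exists>k. int k \<le> K\<^sub>r + 2 * K\<^sub>s + 2 * int K\<^sub>q \<and> \<Delta> k \<le> \<epsilon> \<and> G k \<le> \<epsilon> \<and> \<delta> k \<le> \<epsilon>"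
proof (rule ccontr)
  assume none: "\<not> ?thesis"
  have anti: "\<Delta> (Suc t) \<le> \<Delta> t" for t
  proof (cases "G t > M")
    case False
    moreover have "0 \<le> (G t)\<^sup>2 / (12 * M\<^sup>2)" by simp
    ultimately show ?thesis using small[of t] by linarith
  qed (use large[of t] in simp)
  define n where "n = Suc (nat (K\<^sub>r + 2 * K\<^sub>s + 2 * int K\<^sub>q))"
  define L where "L = {t. G t > M}"
  define A1 where "A1 = {t. K\<^sub>q \<le> t \<and> G t \<le> M \<and> \<Delta> t > \<epsilon>}"
  define A2 where "A2 = {t. K\<^sub>q \<le> t \<and> G t \<le> M \<and> \<Delta> t \<le> \<epsilon> \<and> G t > \<epsilon>}"
  have Ks_real: "48 * M\<^sup>2 / \<epsilon> \<le> of_int K\<^sub>s" unfolding Ks by (rule le_of_int_ceiling)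
  have nonneg: "0 \<le> K\<^sub>r" "0 \<le> K\<^sub>s"
    using \<Delta>0[of 0] \<epsilon> by (auto simp: Kr Ks intro: order.strict_trans2[of _ 0])
  have "(1 / 10.6) * card (L \<inter> {..<n}) \<le> - \<Delta> n - - \<Delta> 0"
    using anti large by (intro potential_card_le) (auto simp: L_def le_diff_eq diff_le_eq algebra_simps)
  then have "card (L \<inter> {..<n}) \<le> 10.6 * \<Delta> 0" using \<Delta>0[of n] by simp
  then have cL: "int (card (L \<inter> {..<n})) \<le> K\<^sub>r" unfolding Kr by (simp add: le_floor_iff)
  have cA1: "int (card (A1 \<inter> {..<n})) \<le> K\<^sub>s + 1"
  proof -
    \<comment> \<open>From \<open>G t \<ge> \<Delta> t / 2\<close>, the decrease
      \<open>(G t)\<^sup>2 / (12 * M\<^sup>2)\<close> is at least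
      \<open>c * (\<Delta> t)\<^sup>2\<close>.\<close>
    define c where "c = 1 / (48 * M\<^sup>2)"
    have c: "c > 0" using M by (simp add: c_def)
    \<comment> \<open>Chosen so that \<open>1 / e = 1 / \<epsilon> + c\<close>: a step from above
      \<open>\<epsilon>\<close> to below \<open>e\<close> still raises the truncated potential by at
      least \<open>c\<close>.\<close>
    define e where "e = 1 / (1 / \<epsilon> + c)"
    have "1 / (1 / \<epsilon> + c) \<le> 1 / (1 / \<epsilon>)" using \<epsilon> c by (intro divide_left_mono) (auto simp: add_pos_pos)
    then have e: "0 < e" "e \<le> \<epsilon>" using \<epsilon> c by (auto simp: e_def add_pos_pos)
    have "c * card (A1 \<inter> {..<n}) \<le> 1 / max (\<Delta> n) e - 1 / max (\<Delta> 0) e"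
    proof (rule potential_card_le)
      fix t
      show "1 / max (\<Delta> t) e \<le> 1 / max (\<Delta> (Suc t)) e"
        using anti[of t] e by (intro divide_left_mono) auto
      assume t: "t \<in> A1"
      then have d: "\<Delta> t > \<epsilon>" "\<Delta> t > 0" and "G t \<le> M" "\<delta> t \<le> \<epsilon> / 2" using Kq \<epsilon> by (auto simp: A1_def)
      then have "\<Delta> t / 2 \<le> G t" using gap[of t] by simp
      then have "(\<Delta> t / 2)\<^sup>2 \<le> (G t)\<^sup>2" using d by (intro power_mono) auto
      then have "(\<Delta> t / 2)\<^sup>2 / (12 * M\<^sup>2) \<le> (G t)\<^sup>2 / (12 * M\<^sup>2)" by (intro divide_right_mono) auto
      then have dec: "\<Delta> (Suc t) \<le> \<Delta> t - c * (\<Delta> t)\<^sup>2"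
        using small[OF \<open>G t \<le> M\<close>] by (simp add: c_def power_divide)
      show "1 / max (\<Delta> t) e + c \<le> 1 / max (\<Delta> (Suc t)) e"
      proof (cases "\<Delta> (Suc t) \<le> e")
        case True
        have "1 / \<Delta> t \<le> 1 / \<epsilon>" using d \<epsilon> by (intro divide_left_mono) auto
        also have "\<dots> + c = 1 / e" by (simp add: e_def)
        finally show ?thesis using True d e by (simp add: max_def)
      next
        case False
        \<comment> \<open>The usual reciprocal argument: a decrease by
          \<open>c * (\<Delta> t)\<^sup>2\<close> raises \<open>1 / \<Delta>\<close> by at least
          \<open>c\<close>.\<close>
        have "(1 / \<Delta> t + c) * \<Delta> (Suc t) \<le> (1 / \<Delta> t + c) * (\<Delta> t - c * (\<Delta> t)\<^sup>2)"
          using dec d c by (intro mult_left_mono) auto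
        also have "\<dots> = 1 - (c * \<Delta> t)\<^sup>2"
          using d by (simp add: field_simps power2_eq_square)
        also have "\<dots> \<le> 1" by simp
        finally have "1 / \<Delta> t + c \<le> 1 / \<Delta> (Suc t)" using False e by (simp add: le_divide_eq)
        then show ?thesis using False d e by (simp add: max_def)
      qed
    qed
    also have "\<dots> \<le> 1 / e"
    proof -
      have "1 / max (\<Delta> n) e \<le> 1 / e" using e by (intro divide_left_mono) auto
      moreover have "0 \<le> 1 / max (\<Delta> 0) e" using e by simp
      ultimately show ?thesis by linarith
    qed
    \<comment> \<open>The truncation at \<open>e\<close> costs one extra step, hence
      \<open>K\<^sub>s + 1\<close>.\<close>
    also have "\<dots> = c * (48 * M\<^sup>2 / \<epsilon> + 1)" using M by (simp add: e_def c_def distrib_left)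
    finally have "card (A1 \<inter> {..<n}) \<le> 48 * M\<^sup>2 / \<epsilon> + 1" using c by simp
    then show ?thesis using Ks_real by linarith
  qed
  have cA2: "int (card (A2 \<inter> {..<n})) \<le> K\<^sub>s"
  proof -
    \<comment> \<open>Truncating at \<open>\<epsilon>\<close> limits the total decrease to
      \<open>\<epsilon>\<close>, whatever \<open>\<Delta> 0\<close> is. Each step in
      \<open>A2\<close> uses up at least \<open>\<epsilon>\<^sup>2 / (12 * M\<^sup>2)\<close> of
      it.\<close>
    have "(\<epsilon>\<^sup>2 / (12 * M\<^sup>2)) * card (A2 \<inter> {..<n}) \<le> - min (\<Delta> n) \<epsilon> - - min (\<Delta> 0) \<epsilon>"
    proof (rule potential_card_le)
      fix t
      show "- min (\<Delta> t) \<epsilon> \<le> - min (\<Delta> (Suc t)) \<epsilon>" using anti[of t] by simp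
      assume "t \<in> A2"
      then have t: "\<Delta> t \<le> \<epsilon>" "\<epsilon> < G t" "G t \<le> M" by (auto simp: A2_def)
      then have "\<epsilon>\<^sup>2 / (12 * M\<^sup>2) \<le> (G t)\<^sup>2 / (12 * M\<^sup>2)" using \<epsilon> by (intro divide_right_mono power_mono) auto
      then show "- min (\<Delta> t) \<epsilon> + \<epsilon>\<^sup>2 / (12 * M\<^sup>2) \<le> - min (\<Delta> (Suc t)) \<epsilon>"
        using small[OF t(3)] anti[of t] t by (simp add: min_def)
    qed
    also have "\<dots> \<le> \<epsilon>" using \<Delta>0[of n] \<epsilon> by (simp add: min_def)
    also have "\<epsilon> = (\<epsilon>\<^sup>2 / (12 * M\<^sup>2)) * (12 * M\<^sup>2 / \<epsilon>)" using \<epsilon> M by (simp add: power2_eq_square)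
    finally have "card (A2 \<inter> {..<n}) \<le> 12 * M\<^sup>2 / \<epsilon>"
      by (rule mult_left_le_imp_le) (use \<epsilon> M in simp)
    also have "\<dots> \<le> 48 * M\<^sup>2 / \<epsilon>" using \<epsilon> by (intro divide_right_mono) auto
    finally show ?thesis using Ks_real by linarith
  qed
  \<comment> \<open>From \<open>K\<^sub>q\<close> on the oracle accuracy is fine, so an index within
    the budget can fail only through \<open>\<Delta>\<close> or \<open>G\<close>, and each such
    failure is in one of the three sets.\<close>
  have "{K\<^sub>q..<n} \<subseteq> (L \<inter> {..<n}) \<union> (A1 \<inter> {..<n}) \<union> (A2 \<inter> {..<n})"
  proof
    fix t assume t: "t \<in> {K\<^sub>q..<n}"
    then have "int t \<le> K\<^sub>r + 2 * K\<^sub>s + 2 * int K\<^sub>q" using nonneg by (auto simp: n_def)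
    moreover have "\<delta> t \<le> \<epsilon>" using Kq(2)[of t] t \<epsilon> by simp
    ultimately have "\<epsilon> < \<Delta> t \<or> \<epsilon> < G t" using none by force
    then show "t \<in> (L \<inter> {..<n}) \<union> (A1 \<inter> {..<n}) \<union> (A2 \<inter> {..<n})"
      using t by (auto simp: L_def A1_def A2_def)
  qed
  then have "card {K\<^sub>q..<n} \<le> card ((L \<inter> {..<n}) \<union> (A1 \<inter> {..<n}) \<union> (A2 \<inter> {..<n}))"
    by (intro card_mono) auto
  also have "\<dots> \<le> card (L \<inter> {..<n}) + card (A1 \<inter> {..<n}) + card (A2 \<inter> {..<n})"
    using card_Un_le[of "(L \<inter> {..<n}) \<union> (A1 \<inter> {..<n})" "A2 \<inter> {..<n}"]
      card_Un_le[of "L \<inter> {..<n}" "A1 \<inter> {..<n}"] by linarith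
  finally have "n - K\<^sub>q \<le> card (L \<inter> {..<n}) + card (A1 \<inter> {..<n}) + card (A2 \<inter> {..<n})" by simp
  \<comment> \<open>The left-hand side equals
    \<open>K\<^sub>r + 2 * K\<^sub>s + K\<^sub>q + 1\<close>: one \<open>K\<^sub>q\<close> of the
    budget pays for the initial indices, the other, being at least 1, yields the
    contradiction.\<close>
  then have "int n - int K\<^sub>q \<le> K\<^sub>r + 2 * K\<^sub>s + 1" using cL cA1 cA2 by linarith
  then show False using nonneg Kq(1) by (simp add: n_def)
qed

subsection \<open>Frank-Wolfe steps\<close>

locale fw_problem = sc_barrier K \<theta> f
  for K :: "'b::euclidean_space set" and \<theta> :: real and f :: "'b \<Rightarrow> real" +
  fixes B :: "'a::euclidean_space \<Rightarrow> 'b" and g :: "'a \<Rightarrow> ereal" and R :: real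
  assumes linear_B: "linear B" and g: "proper_closed_convex g"
    and compact_edom: "compact (edom g)" and variation: "is_max_variation g R"
begin

text \<open>Meaningful on \<open>edom g\<close> only; elsewhere \<open>g\<close> is infinite and the
  value is the default 0.\<close>

definition g' :: "'a \<Rightarrow> real" where "g' x = real_of_ereal (g x)"

definition F :: "'a \<Rightarrow> real" where "F x = f (B x) + g' x"

lemma g_eq: "x \<in> edom g \<Longrightarrow> g x = ereal (g' x)"
  using g by (cases "g x") (auto simp: g'_def edom_def proper_closed_convex_def)

text \<open>Convexity of \<open>g\<close> is given through its epigraph, so the points
  \<open>(x, g' x)\<close> and \<open>(y, g' y)\<close> are combined there.\<close>

lemma g_convex:
  assumes "x \<in> edom g" "y \<in> edom g" "0 \<le> u" "u \<le> 1"
  defines "z \<equiv> (1 - u) *\<^sub>R x + u *\<^sub>R y"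
  shows "z \<in> edom g" "g' z \<le> (1 - u) * g' x + u * g' y"
proof -
  have "convex (eepigraph g)" using g by (simp add: proper_closed_convex_def)
  moreover have "(x, g' x) \<in> eepigraph g" "(y, g' y) \<in> eepigraph g"
    using assms g_eq by (auto simp: eepigraph_def)
  ultimately have "(1 - u) *\<^sub>R (x, g' x) + u *\<^sub>R (y, g' y) \<in> eepigraph g"
    using assms by (intro convexD_alt) auto
  then have le: "g z \<le> ereal ((1 - u) * g' x + u * g' y)" by (simp add: eepigraph_def z_def)
  then show z: "z \<in> edom g" by (auto simp: edom_def)
  show "g' z \<le> (1 - u) * g' x + u * g' y" using le g_eq[OF z] by simp
qed

lemma g_variation: "x \<in> edom g \<Longrightarrow> y \<in> edom g \<Longrightarrow> \<bar>g' x - g' y\<bar> \<le> R"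
  using variation g_eq unfolding is_max_variation_def by fastforce

lemma feasible_convex:
  assumes "feasible K B g x" "feasible K B g y" "0 \<le> u" "u \<le> 1"
  shows "feasible K B g ((1 - u) *\<^sub>R x + u *\<^sub>R y)"
  using assms g_convex(1) convexD_alt[OF convex_interior]
  by (auto simp: feasible_def linear_add[OF linear_B] linear_cmul[OF linear_B])

lemma objective_feasible: "feasible K B g x \<Longrightarrow> objective K f B g x = ereal (F x)"
  using g_eq by (auto simp: feasible_def objective_def F_def)

lemma objective_infeasible: "\<not> feasible K B g x \<Longrightarrow> objective K f B g x = \<infinity>"
  by (auto simp: feasible_def objective_def edom_def)

lemma lin_objective_edom:
  "y \<in> edom g \<Longrightarrow> lin_objective f B g x y = ereal (grad f (B x) \<bullet> B y + g' y)"
  using g_eq adjoint_works[OF linear_B, of y "grad f (B x)"]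
  by (simp add: lin_objective_def inner_commute)

text \<open>Minimize over the part of the epigraph of \<open>g\<close> whose height is within \<open>R\<close> of \<open>g x\<^sub>0\<close>;
  it is compact.\<close>
lemma lin_objective_minimizer:
  "\<exists>hstar\<in>edom g. is_minimizer (lin_objective f B g x) hstar"
proof -
  obtain x0 where x0: "x0 \<in> edom g" using g by (auto simp: proper_closed_convex_def)
  define S where "S = eepigraph g \<inter> (edom g \<times> {g' x0 - R .. g' x0 + R})"
  have "compact S" unfolding S_def using g compact_edom
    by (intro closed_Int_compact compact_Times compact_Icc) (auto simp: proper_closed_convex_def)
  \<comment> \<open>The variation bound puts the whole graph over \<open>edom g\<close> into
    \<open>S\<close>, so truncating the epigraph loses no candidate.\<close>
  have S: "(y, g' y) \<in> S" if "y \<in> edom g" for y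
    using that g_eq[OF that] g_variation[OF that x0] by (auto simp: S_def eepigraph_def abs_le_iff)
  have "continuous_on S (\<lambda>p. B (fst p))"
    by (rule linear_continuous_on_compose[OF _ linear_B]) (intro continuous_intros)
  then have "continuous_on S (\<lambda>(y, r). grad f (B x) \<bullet> B y + r)"
    unfolding case_prod_beta by (intro continuous_intros)
  from continuous_attains_inf[OF \<open>compact S\<close> _ this] S[OF x0]
  obtain p where p: "p \<in> S" "\<And>q. q \<in> S \<Longrightarrow>
      (case p of (y, r) \<Rightarrow> grad f (B x) \<bullet> B y + r) \<le> (case q of (y, r) \<Rightarrow> grad f (B x) \<bullet> B y + r)" by blast
  obtain h r where hr: "p = (h, r)" by (cases p)
  \<comment> \<open>The minimizing pair is only known to lie on or above the graph; lowering
    \<open>r\<close> to \<open>g' h\<close> cannot increase the value.\<close>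
  have h: "h \<in> edom g" and "g h \<le> ereal r" using p(1) by (auto simp: hr S_def eepigraph_def)
  then have r: "g' h \<le> r" using g_eq by simp
  have "lin_objective f B g x h \<le> lin_objective f B g x y" for y
  proof (cases "y \<in> edom g")
    case True
    from p(2)[OF S[OF True]] r show ?thesis by (simp add: hr lin_objective_edom h True)
  next
    case False
    then show ?thesis by (simp add: lin_objective_def edom_def)
  qed
  then have "is_minimizer (lin_objective f B g x) h"
    by (auto simp: is_minimizer_def is_arg_min_def not_less)
  with h show ?thesis by blast
qed

lemma minimizer_feasible:
  assumes "is_minimizer (objective K f B g) xstar" "feasible K B g y"
  shows "feasible K B g xstar" "F xstar \<le> F y"
proof -
  have "objective K f B g xstar \<le> objective K f B g y"
    using assms(1) by (auto simp: is_minimizer_def is_arg_min_def not_less)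
  then have le: "objective K f B g xstar \<le> ereal (F y)" by (simp add: objective_feasible assms)
  then show x: "feasible K B g xstar" using objective_infeasible[of xstar] by fastforce
  show "F xstar \<le> F y" using le by (simp add: objective_feasible x)
qed

lemma opt_gap_feasible:
  "feasible K B g xstar \<Longrightarrow> feasible K B g x \<Longrightarrow> opt_gap K f B g xstar x = F x - F xstar"
  by (simp add: opt_gap_def objective_feasible)

lemma oracle_gap_eq:
  assumes "feasible K B g x" "ilmo_answer K \<theta> f B g R x d h G"
  shows "G = - (grad f (B x) \<bullet> B (h - x)) + g' x - g' h"
proof -
  have "x \<in> edom g" "h \<in> edom g" using assms by (auto simp: ilmo_answer_def feasible_def)
  then show ?thesis using assms(2)
    by (simp add: ilmo_answer_def lin_objective_edom linear_diff[OF linear_B] inner_diff_right)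
qed

text \<open>A gap of at most \<open>\<theta> + R\<close> excludes the large gap alternative, so
  \<open>h\<close> is \<open>d\<close>-suboptimal. This is stated relative to minimizers, whence the
  need for one to exist. Replacing \<open>f\<close> by its tangent at \<open>B x\<close> then bounds
  \<open>F x - F y\<close> by a difference of linearized values.\<close>

lemma gap_upper_bound:
  assumes x: "feasible K B g x" and y: "feasible K B g y"
    and a: "ilmo_answer K \<theta> f B g R x d h G" and G: "G \<le> \<theta> + R"
  shows "F x - F y \<le> G + d"
proof -
  obtain hs where hs: "hs \<in> edom g" and min: "is_minimizer (lin_objective f B g x) hs"
    using lin_objective_minimizer by blast
  have h: "h \<in> edom g" using a by (simp add: ilmo_answer_def feasible_def)
  have "lin_objective f B g x h \<le> lin_objective f B g x hs + ereal d"
    using a G min by (auto simp: ilmo_answer_def)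
  moreover have "lin_objective f B g x hs \<le> lin_objective f B g x y"
    using min by (auto simp: is_minimizer_def is_arg_min_def not_less)
  ultimately have 1: "grad f (B x) \<bullet> B h + g' h \<le> grad f (B x) \<bullet> B y + g' y + d"
    using x y h hs by (simp add: lin_objective_edom feasible_def)
  have "f (B x) + grad f (B x) \<bullet> (B y - B x) \<le> f (B y)"
    using x y by (intro tangent_below) (auto simp: feasible_def)
  with 1 oracle_gap_eq[OF x a] show ?thesis
    by (simp add: F_def linear_diff[OF linear_B] inner_diff_right)
qed

text \<open>By \<open>grad_self\<close>,
  \<open>- (grad f (B x) \<bullet> B h) = G + \<theta> + g' h - g' x\<close>, and the variation of
  \<open>g\<close> is at most \<open>R\<close>. So \<open>local_norm_diff_le\<close> applies with
  \<open>q = G + (\<theta> + R)\<close>.\<close>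

lemma local_norm_direction_le:
  assumes x: "feasible K B g x" and a: "ilmo_answer K \<theta> f B g R x d h G"
  shows "local_norm f (B x) (B (h - x)) \<le> G + (\<theta> + R)"
proof -
  have h: "feasible K B g h" and G0: "0 \<le> G" using a by (auto simp: ilmo_answer_def)
  have gv: "g' h - g' x \<le> R" and R0: "0 \<le> R"
    using g_variation[of x h] g_variation[of x x] x h by (auto simp: feasible_def)
  have "local_norm f (B x) (B h - B x) \<le> G + (\<theta> + R)"
  proof (rule local_norm_diff_le)
    show "- (grad f (B x) \<bullet> B h) \<le> G + (\<theta> + R)"
      using oracle_gap_eq[OF x a] grad_self[of "B x"] x gv
      by (simp add: feasible_def linear_diff[OF linear_B] inner_diff_right)
  qed (use x h G0 R0 in \<open>auto simp: feasible_def\<close>)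
  then show ?thesis by (simp add: linear_diff[OF linear_B])
qed

text \<open>The upper self-concordance bound for \<open>f\<close> along
  \<open>\<gamma> *\<^sub>R B (h - x)\<close>, valid as \<open>\<gamma> * D < 1\<close>, is added to
  convexity of \<open>g\<close>. The first-order terms sum to \<open>- \<gamma> * G\<close>, leaving
  the decrease estimated in \<open>step_size_decrease\<close>.\<close>

lemma iterate_step:
  fixes x h :: 'a
  assumes x: "feasible K B g x" and a: "ilmo_answer K \<theta> f B g R x d h G"
  defines "\<gamma> \<equiv> step_size G (local_norm f (B x) (B (h - x)))"
  defines "y \<equiv> (1 - \<gamma>) *\<^sub>R x + \<gamma> *\<^sub>R h"
  shows "feasible K B g y" "G > \<theta> + R \<Longrightarrow> F y \<le> F x - 1 / 10.6"
    "G \<le> \<theta> + R \<Longrightarrow> F y \<le> F x - G\<^sup>2 / (12 * (\<theta> + R)\<^sup>2)"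
proof -
  define D where "D = local_norm f (B x) (B (h - x))"
  have h: "feasible K B g h" and G0: "0 \<le> G" using a by (auto simp: ilmo_answer_def)
  have w: "B x \<in> interior K" using x by (simp add: feasible_def)
  have R0: "0 \<le> R" using g_variation[of x x] x by (auto simp: feasible_def)
  then have M: "1 \<le> \<theta> + R" using theta_ge_1[OF w] by simp
  have D0: "0 \<le> D" using local_norm_nonneg[OF w] by (simp add: D_def)
  note st = step_size_decrease[OF G0 D0 M local_norm_direction_le[OF x a, folded D_def], folded D_def]
  have \<gamma>: "\<gamma> = step_size G D" by (simp add: \<gamma>_def D_def)
  note st = st[folded \<gamma>]
  show y: "feasible K B g y" unfolding y_def using x h st by (intro feasible_convex) auto
  have By: "B x + \<gamma> *\<^sub>R B (h - x) = B y"
    by (simp add: y_def linear_diff[OF linear_B] linear_add[OF linear_B] linear_cmul[OF linear_B] algebra_simps)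
  have "f (B y) \<le> f (B x) + \<gamma> * (grad f (B x) \<bullet> B (h - x)) + (- (\<gamma> * D) - ln (1 - \<gamma> * D))"
    using self_concordant_bounds(2)[OF w, of "\<gamma> *\<^sub>R B (h - x)"] y st(1,3)
    by (simp add: By local_norm_scale[OF w] feasible_def D_def)
  moreover have "g' y \<le> (1 - \<gamma>) * g' x + \<gamma> * g' h"
    unfolding y_def using x h st by (intro g_convex) (auto simp: feasible_def)
  moreover have "\<gamma> * G = - \<gamma> * (grad f (B x) \<bullet> B (h - x)) + \<gamma> * g' x - \<gamma> * g' h"
    unfolding oracle_gap_eq[OF x a] by (simp add: algebra_simps)
  ultimately have dec: "F y \<le> F x - (\<gamma> * G + \<gamma> * D + ln (1 - \<gamma> * D))"
    by (simp add: F_def algebra_simps)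
  show "G > \<theta> + R \<Longrightarrow> F y \<le> F x - 1 / 10.6" using dec st(4) by linarith
  show "G \<le> \<theta> + R \<Longrightarrow> F y \<le> F x - G\<^sup>2 / (12 * (\<theta> + R)\<^sup>2)" using dec st(5) by linarith
qed

end

theorem lemma5:
  fixes K :: "'b::euclidean_space set"
    and f :: "'b \<Rightarrow> real"
    and B :: "'a::euclidean_space \<Rightarrow> 'b"
    and g :: "'a \<Rightarrow> ereal"
    and \<theta> R\<^sub>g \<epsilon> :: real
    and \<delta> G :: "nat \<Rightarrow> real"
    and x h :: "nat \<Rightarrow> 'a"
    and xstar :: 'a
    and K\<^sub>q :: nat
    and K\<^sub>r K\<^sub>s :: int
  assumes "proper_cone K"
    and "self_concordant_lh_barrier K \<theta> f"
    and "linear B"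
    and "proper_closed_convex g"
    and "compact (edom g)"
    and "interior K \<inter> B ` edom g \<noteq> {}"
    and "is_max_variation g R\<^sub>g"
    and "is_minimizer (objective K f B g) xstar"
    and "0 < \<epsilon>" and "\<epsilon> \<le> \<theta> + R\<^sub>g"
    and "\<And>t. \<delta> t \<ge> 0" and "\<delta> \<longlonglongrightarrow> 0"
    and "agfw_iterates K \<theta> f B g R\<^sub>g \<delta> x h G"
    and "K\<^sub>q = (LEAST k. k \<ge> 1 \<and> (\<forall>t\<ge>k. \<delta> t \<le> \<epsilon> / 2))"
    and "K\<^sub>r = \<lfloor>10.6 * opt_gap K f B g xstar (x 0)\<rfloor>"
    and "K\<^sub>s = \<lceil>48 * (\<theta> + R\<^sub>g)^2 / \<epsilon>\<rceil>"
  shows "\<exists>k. int k \<le> K\<^sub>r + 2 * K\<^sub>s + 2 * int K\<^sub>q \<and>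
             opt_gap K f B g xstar (x k) \<le> \<epsilon> \<and> G k \<le> \<epsilon> \<and> \<delta> k \<le> \<epsilon>"
proof -
  interpret fw_problem K \<theta> f B g R\<^sub>g
    by (intro fw_problem.intro sc_barrier.intro fw_problem_axioms.intro assms(1-5,7))
  define M where "M = \<theta> + R\<^sub>g"
  have M: "0 < M" using assms by (simp add: M_def)
  have iter: "feasible K B g (x 0)" "\<And>t. ilmo_answer K \<theta> f B g R\<^sub>g (x t) (\<delta> t) (h t) (G t)"
    "\<And>t. x (Suc t) = (1 - step_size (G t) (local_norm f (B (x t)) (B (h t - x t)))) *\<^sub>R x t +
      step_size (G t) (local_norm f (B (x t)) (B (h t - x t))) *\<^sub>R h t"
    using assms(13) by (auto simp: agfw_iterates_def Let_def)
  have feas: "feasible K B g (x t)" for t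
  proof (induction t)
    case (Suc t)
    show ?case unfolding iter(3) by (rule iterate_step(1)[OF Suc iter(2)])
  qed (rule iter(1))
  note xstar = minimizer_feasible[OF assms(8)]
  have \<Delta>: "opt_gap K f B g xstar (x t) = F (x t) - F xstar" for t
    using opt_gap_feasible xstar(1)[OF feas] feas by blast
  have ex: "\<exists>k. k \<ge> 1 \<and> (\<forall>t\<ge>k. \<delta> t \<le> \<epsilon> / 2)"
  proof -
    have "\<forall>\<^sub>F t in sequentially. \<delta> t < \<epsilon> / 2"
      using assms(9,12) by (intro order_tendstoD(2)) auto
    then obtain k where "\<And>t. k \<le> t \<Longrightarrow> \<delta> t < \<epsilon> / 2" by (auto simp: eventually_sequentially)
    \<comment> \<open>\<open>Suc k\<close> rather than \<open>k\<close>, to meet the requirement of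
      being at least 1.\<close>
    then show ?thesis by (intro exI[of _ "Suc k"]) (auto intro: less_imp_le)
  qed
  have Kq: "K\<^sub>q \<ge> 1 \<and> (\<forall>t\<ge>K\<^sub>q. \<delta> t \<le> \<epsilon> / 2)"
    unfolding assms(14) by (rule LeastI_ex[OF ex])
  show ?thesis
  proof (rule descent_complexity[OF M assms(9)])
    fix t
    show "0 \<le> opt_gap K f B g xstar (x t)" using xstar(2)[OF feas[of t]] by (simp add: \<Delta>)
    show "opt_gap K f B g xstar (x (Suc t)) \<le> opt_gap K f B g xstar (x t) - 1 / 10.6" if "G t > M"
      using iterate_step(2)[OF feas iter(2), folded iter(3), folded M_def, OF that] unfolding \<Delta> by linarith
    show "opt_gap K f B g xstar (x (Suc t)) \<le> opt_gap K f B g xstar (x t) - (G t)\<^sup>2 / (12 * M\<^sup>2)" if "G t \<le> M"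
      using iterate_step(3)[OF feas iter(2), folded iter(3), folded M_def, OF that] unfolding \<Delta> by linarith
    show "opt_gap K f B g xstar (x t) \<le> G t + \<delta> t" if "G t \<le> M"
      using gap_upper_bound[OF feas xstar(1)[OF feas] iter(2)] that unfolding \<Delta> M_def by blast
  qed (use Kq assms(15,16) in \<open>auto simp: M_def\<close>)
qed

end
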